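(* Let $n,m,M$ be positive integers, let $A_1,\dots,A_M\in\mathbb{R}^{n\times n}$, $B\in\mathbb{R}^{n\times m}$, $\mathcal{M}=\{1,\dots,M\}$, and consider the switched linear system $x(t+1)=A_{\sigma(t)}x(t)+Bu(t)$, $t\in\mathbb{Z}^+$, with arbitrary switching signal $\sigma:\mathbb{Z}^+\to\mathcal{M}$. Given $N\in\mathbb{Z}^+$, let $\omega_N=\{(x_i,\sigma_i)\}_{i=1}^N\subset\mathbb{S}\times\mathcal{M}$ be i.i.d. with respect to the uniform distribution $\mathbb{P}$ over $\mathbb{S}\times\mathcal{M}$, and let $\gamma(\omega_N)$, $P(\omega_N)$, $K(\omega_N)$ be the output of Algorithm 1 (described in the context) run on $\omega_N$, $B$ and some tolerance $\epsilon_{tol}>0$. Then, for any $\epsilon\in(0,1)$, with probability no smaller than $1-\mathcal{B}(\epsilon;N)$, the joint spectral radius of the closed-loop system $x(t+1)=(A_{\sigma(t)}+BK)x(t)$ with $K=K(\omega_N)$ satisfies $$\rho(\mathcal{A}_{K(\omega_N)})\le \frac{\gamma(\omega_N)}{1-\kappa(P(\omega_N))\bigl(1-\cos(\delta^{-1}(\epsilon))\bigr)},$$ where $$\mathcal{B}(\epsilon;N)=\frac{M\left(1-\frac{\delta\left(\frac12\delta^{-1}(\epsilon)\right)}{M}\right)^N}{\delta\left(\frac14\delta^{-1}(\epsilon)\right)},$$ with the convention that if $\kappa(P(\omega_N))(1-\cos(\delta^{-1}(\epsilon)))\ge 1$ the right-hand side of the bound is $+\infty$.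
   Context: $\mathbb{S}$ is the unit sphere in $\mathbb{R}^n$ and $\mu$ the uniform (rotation-invariant) probability measure on $\mathbb{S}$. The uniform distribution on $\mathbb{S}\times\mathcal{M}$ is the product of $\mu$ and the uniform distribution on $\mathcal{M}$. For $x\in\mathbb{S}$ and $\theta\in[0,\pi/2]$, $\mathrm{Cap}(x,\theta)=\{v\in\mathbb{S}:|x^\top v|\ge\cos\theta\}$, and $\delta(\theta)=\mu(\mathrm{Cap}(x,\theta))$ (independent of $x$); $\delta$ is strictly increasing from $[0,\pi/2]$ onto $[0,1]$ and $\delta^{-1}$ denotes its inverse. For $P\succ0$, $\kappa(P)=\lambda_{\max}(P)/\lambda_{\min}(P)$. For $K\in\mathbb{R}^{m\times n}$, $\mathcal{A}_K=\{A_1+BK,\dots,A_M+BK\}$ and its joint spectral radius is $\rho(\mathcal{A}_K)=\lim_{k\to\infty}\max_{(\sigma_0,\dots,\sigma_{k-1})\in\mathcal{M}^k}\|(A_{\sigma_{k-1}}+BK)\cdots(A_{\sigma_0}+BK)\|^{1/k}$. Algorithm 1 (uses only $B$, the sample points $x$ and the observed successors $A_\sigma x$ for $(x,\sigma)\in\omega_N$): define Problem (K-step) for fixed $P$: minimize $\gamma\ge0$ over $(\gamma,K)$ subject to $\begin{pmatrix}\gamma^2x^\top Px & (A_\sigma x+BKx)^\top P\\ P(A_\sigma x+BKx) & P\end{pmatrix}\succeq0$ for all $(x,\sigma)\in\omega_N$. Define Problem (P-step) for fixed $K$: minimize $\gamma\ge0$ over $(\gamma,P)$ subject to $(A_\sigma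 x+BKx)^\top P(A_\sigma x+BKx)\le\gamma^2x^\top Px$ for all $(x,\sigma)\in\omega_N$ and $P\succeq I$. Initialize $k=0$, $P_0=I_n$, and $(K_0,\gamma_0)$ a solution of (K-step) with $P=P_0$. Iterate: obtain $P_{k+1}$ from (P-step) with $K=K_k$; obtain $(K_{k+1},\gamma_{k+1})$ from (K-step) with $P=P_{k+1}$; if $|\gamma_{k+1}-\gamma_k|<\epsilon_{tol}$, output $\gamma(\omega_N)=\gamma_{k+1}$, $P(\omega_N)=P_{k+1}$, $K(\omega_N)=K_{k+1}$ and stop; otherwise set $k\leftarrow k+1$ and repeat. *)

theory Defs
  imports "HOL-Probability.Probability"
begin

text \<open>Uniform (rotation-invariant) probability measure on the unit sphere of R^n:
  push-forward of the uniform distribution on the unit ball under radial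
  projection x |-> x / |x| (cone measure = normalised surface measure).
  The point 0 (a null set) is mapped to 0 by sgn.\<close>
definition unif_sphere :: "(real^'n) measure" where
  "unif_sphere = distr (uniform_measure lborel (ball 0 1)) borel (\<lambda>x. sgn x)"

definition Cap :: "real^'n \<Rightarrow> real \<Rightarrow> (real^'n) set" where
  "Cap x \<theta> = {v \<in> sphere 0 1. \<bar>x \<bullet> v\<bar> \<ge> cos \<theta>}"

text \<open>delta(theta) = mu(Cap(x,theta)); it does not depend on x, we use a fixed unit vector.\<close>
definition delta :: "'n::finite itself \<Rightarrow> real \<Rightarrow> real" where
  "delta _ \<theta> = measure (unif_sphere :: (real^'n) measure)
                  (Cap (SOME x::real^'n. x \<in> sphere 0 1) \<theta>)"

definition delta_inv :: "'n::finite itself \<Rightarrow> real \<Rightarrow> real" where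
  "delta_inv T e = (THE \<theta>. 0 \<le> \<theta> \<and> \<theta> \<le> pi/2 \<and> delta T \<theta> = e)"

definition psd :: "real^'n^'n \<Rightarrow> bool" where
  "psd P \<longleftrightarrow> transpose P = P \<and> (\<forall>z. 0 \<le> z \<bullet> (P *v z))"

definition is_eigenvalue :: "real^'n^'n \<Rightarrow> real \<Rightarrow> bool" where
  "is_eigenvalue P l \<longleftrightarrow> (\<exists>v. v \<noteq> 0 \<and> P *v v = l *\<^sub>R v)"

definition lambda_max :: "real^'n^'n \<Rightarrow> real" where
  "lambda_max P = Max {l. is_eigenvalue P l}"

definition lambda_min :: "real^'n^'n \<Rightarrow> real" where
  "lambda_min P = Min {l. is_eigenvalue P l}"

definition kappa :: "real^'n^'n \<Rightarrow> real" where
  "kappa P = lambda_max P / lambda_min P"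

definition sw_prod :: "(nat \<Rightarrow> real^'n^'n) \<Rightarrow> nat list \<Rightarrow> real^'n^'n" where
  "sw_prod F s = foldl (\<lambda>Q i. F i ** Q) (mat 1) s"

definition jsr :: "(nat \<Rightarrow> real^'n^'n) \<Rightarrow> nat set \<Rightarrow> real" where
  "jsr F I = lim (\<lambda>k. Max ((\<lambda>s. onorm (\<lambda>x. sw_prod F s *v x) powr (1 / real k))
                          ` {s. length s = k \<and> set s \<subseteq> I}))"

text \<open>Constraint of Problem (K-step) for one sample: the block matrix
  [[g^2 x'Px, y'P],[Py, P]] with y = A_sigma x + B K x is positive semidefinite,
  written out via its quadratic form in (t, z).\<close>
definition Kstep_feas ::
  "(nat \<Rightarrow> real^'n^'n) \<Rightarrow> real^'m^'n \<Rightarrow> ((real^'n) \<times> nat) set \<Rightarrow> real^'n^'n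
   \<Rightarrow> real \<Rightarrow> real^'n^'m \<Rightarrow> bool" where
  "Kstep_feas A B S P g K \<longleftrightarrow> 0 \<le> g \<and>
     (\<forall>(x,\<sigma>)\<in>S. let y = A \<sigma> *v x + B *v (K *v x) in
        \<forall>(t::real) z. 0 \<le> t^2 * g^2 * (x \<bullet> (P *v x)) + 2 * t * (z \<bullet> (P *v y)) + z \<bullet> (P *v z))"

definition Kstep_sol ::
  "(nat \<Rightarrow> real^'n^'n) \<Rightarrow> real^'m^'n \<Rightarrow> ((real^'n) \<times> nat) set \<Rightarrow> real^'n^'n
   \<Rightarrow> real \<Rightarrow> real^'n^'m \<Rightarrow> bool" where
  "Kstep_sol A B S P g K \<longleftrightarrow> Kstep_feas A B S P g K \<and>
     (\<forall>g' K'. Kstep_feas A B S P g' K' \<longrightarrow> g \<le> g')"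

definition Pstep_feas ::
  "(nat \<Rightarrow> real^'n^'n) \<Rightarrow> real^'m^'n \<Rightarrow> ((real^'n) \<times> nat) set \<Rightarrow> real^'n^'m
   \<Rightarrow> real \<Rightarrow> real^'n^'n \<Rightarrow> bool" where
  "Pstep_feas A B S K g P \<longleftrightarrow> 0 \<le> g \<and> psd (P - mat 1) \<and>
     (\<forall>(x,\<sigma>)\<in>S. let y = A \<sigma> *v x + B *v (K *v x) in
        y \<bullet> (P *v y) \<le> g^2 * (x \<bullet> (P *v x)))"

definition Pstep_sol ::
  "(nat \<Rightarrow> real^'n^'n) \<Rightarrow> real^'m^'n \<Rightarrow> ((real^'n) \<times> nat) set \<Rightarrow> real^'n^'m
   \<Rightarrow> real \<Rightarrow> real^'n^'n \<Rightarrow> bool" where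
  "Pstep_sol A B S K g P \<longleftrightarrow> Pstep_feas A B S K g P \<and>
     (\<forall>g' P'. Pstep_feas A B S K g' P' \<longrightarrow> g \<le> g')"

text \<open>alg1_output A B S tol g P K: (g,P,K) is a possible output of Algorithm 1 run on the
  sample set S (solvers may return any optimal solution).\<close>
definition alg1_output ::
  "(nat \<Rightarrow> real^'n^'n) \<Rightarrow> real^'m^'n \<Rightarrow> ((real^'n) \<times> nat) set \<Rightarrow> real
   \<Rightarrow> real \<Rightarrow> real^'n^'n \<Rightarrow> real^'n^'m \<Rightarrow> bool" where
  "alg1_output A B S tol g P K \<longleftrightarrow>
     (\<exists>(Ps :: nat \<Rightarrow> real^'n^'n) (Ks :: nat \<Rightarrow> real^'n^'m) (gs :: nat \<Rightarrow> real) k.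
        Ps 0 = mat 1 \<and> Kstep_sol A B S (Ps 0) (gs 0) (Ks 0) \<and>
        (\<forall>j\<le>k. (\<exists>g'. Pstep_sol A B S (Ks j) g' (Ps (Suc j))) \<and>
                Kstep_sol A B S (Ps (Suc j)) (gs (Suc j)) (Ks (Suc j))) \<and>
        (\<forall>j<k. \<not> \<bar>gs (Suc j) - gs j\<bar> < tol) \<and>
        \<bar>gs (Suc k) - gs k\<bar> < tol \<and>
        g = gs (Suc k) \<and> P = Ps (Suc k) \<and> K = Ks (Suc k))"

definition sample_space :: "'n::finite itself \<Rightarrow> nat \<Rightarrow> nat \<Rightarrow> (nat \<Rightarrow> (real^'n) \<times> nat) measure" where
  "sample_space _ M N = PiM {0..<N} (\<lambda>_. (unif_sphere :: (real^'n) measure) \<Otimes>\<^sub>M uniform_count_measure {1..M})"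

definition conf_bound :: "'n::finite itself \<Rightarrow> nat \<Rightarrow> real \<Rightarrow> nat \<Rightarrow> real" where
  "conf_bound T M e N =
     real M * (1 - delta T (delta_inv T e / 2) / real M) ^ N / delta T (delta_inv T e / 4)"

end

theory Submission
  imports Defs
begin

text \<open>Let \<open>C = A\<^sub>i + B K\<close>, let \<open>\<bar>x\<bar>\<^sub>P\<close> be the norm of the form \<open>x \<bullet> P x\<close>, and let \<open>v\<close> maximise
  \<open>\<bar>C v\<bar>\<^sub>P / \<bar>v\<bar>\<^sub>P\<close>. If every point of the sphere is, up to sign, within angle \<open>\<theta>\<close> of a sample of
  mode \<open>i\<close>, choose such a sample \<open>y\<close> for \<open>v\<close>. Its \<open>P\<close>-cosine with \<open>v\<close> is at least
  \<open>1 - \<kappa>(P) (1 - cos \<theta>)\<close>, and Cauchy-Schwarz for \<open>C\<^sup>T P C\<close> together with \<open>\<bar>C y\<bar>\<^sub>P \<le> \<gamma> \<bar>y\<bar>\<^sub>P\<close>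
  bounds the \<open>P\<close>-norm of \<open>C\<close>, hence the joint spectral radius.

  For the probability, the centres \<open>Z\<close> of a maximal packing by caps of radius \<open>\<theta>/4\<close> number at most
  \<open>1/\<delta>(\<theta>/4)\<close> and come within \<open>\<theta>/2\<close> of every point. If each of the sets
  \<open>Cap z (\<theta>/2) \<times> {i}\<close> contains a sample, the samples are \<open>\<theta>\<close>-dense in every mode; the union bound
  over \<open>z\<close> and \<open>i\<close> gives the failure probability.\<close>

section \<open>Quadratic forms and the contraction bound\<close>

text \<open>The form is nonnegative along \<open>y + t *\<^sub>R v\<close>, so this quadratic in
  \<open>t\<close> has no positive discriminant. For \<open>d = 0\<close> it is affine and its slope
  must vanish.\<close>

lemma psd_Cauchy_Schwarz:
  fixes Q :: "real^'n^'n"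
  assumes "psd Q"
  shows "(y \<bullet> (Q *v v))\<^sup>2 \<le> (y \<bullet> (Q *v y)) * (v \<bullet> (Q *v v))"
proof -
  have sym: "v \<bullet> (Q *v y) = y \<bullet> (Q *v v)"
    using assms by (metis psd_def dot_lmul_matrix inner_commute transpose_matrix_vector)
  define a b d where "a = y \<bullet> (Q *v y)" and "b = y \<bullet> (Q *v v)" and "d = v \<bullet> (Q *v v)"
  have pos: "0 \<le> a + 2 * t * b + t\<^sup>2 * d" for t
  proof -
    have "0 \<le> (y + t *\<^sub>R v) \<bullet> (Q *v (y + t *\<^sub>R v))"
      using assms by (simp add: psd_def)
    also have "\<dots> = a + 2 * t * b + t\<^sup>2 * d"
      by (simp add: a_def b_def d_def sym algebra_simps inner_add_left inner_add_right
          matrix_vector_mult_scaleR power2_eq_square)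
    finally show ?thesis .
  qed
  have "0 \<le> d"
    using assms by (simp add: psd_def d_def)
  have "b\<^sup>2 \<le> a * d"
  proof (cases "d = 0")
    case True
    have "b = 0"
    proof (rule ccontr)
      assume "b \<noteq> 0"
      then show False
        \<comment> \<open>With \<open>d = 0\<close> this \<open>t\<close> makes the affine function
          equal to \<open>-1\<close>.\<close>
        using pos[of "- (a + 1) / (2 * b)"] True by (simp add: field_simps)
    qed
    then show ?thesis using True by simp
  next
    case False
    have "0 \<le> a - b\<^sup>2 / d"
      using pos[of "- b / d"] False by (simp add: power2_eq_square field_simps)
    then show ?thesis
      using False \<open>0 \<le> d\<close> by (simp add: field_simps)
  qed
  then show ?thesis by (simp add: a_def b_def d_def)
qed

text \<open>Cauchy-Schwarz with \<open>y = Q *v v\<close> bounds the fourth power of the norm of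
  \<open>Q *v v\<close> by \<open>0\<close>.\<close>

lemma psd_mult_eq_0:
  fixes Q :: "real^'n^'n"
  assumes "psd Q" "v \<bullet> (Q *v v) = 0"
  shows "Q *v v = 0"
  using psd_Cauchy_Schwarz[OF assms(1), of "Q *v v" v] assms(2) by simp

text \<open>The quotient attains its maximum \<open>m\<close> on the compact sphere. Then
  \<open>m *\<^sub>R P - F\<close> is positive semidefinite and its form vanishes at the maximiser,
  which therefore lies in its kernel. Taking \<open>P = mat 1\<close> yields ordinary
  eigenvalues.\<close>

lemma generalized_Rayleigh:
  fixes F P :: "real^'n^'n"
  assumes F: "transpose F = F" and P: "transpose P = P"
    and pos: "\<And>x. x \<noteq> 0 \<Longrightarrow> 0 < x \<bullet> (P *v x)"
  obtains v m where "norm v = 1" "F *v v = m *\<^sub>R (P *v v)"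
    "\<And>x. x \<bullet> (F *v x) \<le> m * (x \<bullet> (P *v x))"
proof -
  let ?q = "\<lambda>x. (x \<bullet> (F *v x)) / (x \<bullet> (P *v x))"
  have nz: "x \<bullet> (P *v x) \<noteq> 0" if "x \<noteq> 0" for x
    using pos[OF that] by simp
  have "continuous_on (sphere 0 1) ?q"
    by (intro continuous_intros ballI nz) auto
  moreover have "sphere 0 1 \<noteq> ({} :: (real^'n) set)"
    by simp
  ultimately obtain v where v: "norm v = 1" and max: "\<And>x. norm x = 1 \<Longrightarrow> ?q x \<le> ?q v"
    using continuous_attains_sup[of "sphere 0 1" ?q] by auto
  define m where "m = ?q v"
  have le: "x \<bullet> (F *v x) \<le> m * (x \<bullet> (P *v x))" for x
  proof (cases "x = 0")
    case False
    have "?q (sgn x) = ?q x"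
      using False by (simp add: sgn_div_norm matrix_vector_mult_scaleR)
    then have "?q x \<le> m"
      using max[of "sgn x"] False by (simp add: m_def norm_sgn)
    then show ?thesis
      using pos[OF False] by (simp add: field_simps)
  qed simp
  let ?Q = "m *\<^sub>R P - F"
  have Q: "?Q *v x = m *\<^sub>R (P *v x) - F *v x" for x
    by (simp add: matrix_vector_mult_diff_rdistrib scaleR_matrix_vector_assoc)
  have "transpose ?Q = ?Q"
    using F P by (simp add: transpose_def vec_eq_iff)
  then have "psd ?Q"
    using le by (simp add: psd_def Q inner_diff_right)
  moreover have "v \<bullet> (?Q *v v) = 0"
    unfolding Q using nz[of v] v by (force simp: inner_diff_right m_def)
  ultimately have "?Q *v v = 0"
    by (rule psd_mult_eq_0)
  then show ?thesis
    using that[OF v _ le] by (simp add: Q)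
qed

section \<open>Extreme eigenvalues of a symmetric matrix\<close>

text \<open>Eigenvectors for distinct eigenvalues are orthogonal, hence independent. Finiteness
  gives the \<open>Max\<close> and \<open>Min\<close> in \<open>lambda_max\<close> and
  \<open>lambda_min\<close> their meaning.\<close>

lemma finite_eigenvalues:
  fixes P :: "real^'n^'n"
  assumes "transpose P = P"
  shows "finite {l. is_eigenvalue P l}"
proof -
  have "\<forall>l. \<exists>v. is_eigenvalue P l \<longrightarrow> v \<noteq> 0 \<and> P *v v = l *\<^sub>R v"
    by (auto simp: is_eigenvalue_def)
  then obtain f where f: "\<And>l. is_eigenvalue P l \<Longrightarrow> f l \<noteq> 0 \<and> P *v f l = l *\<^sub>R f l"
    by metis
  let ?E = "{l. is_eigenvalue P l}"
  have orth: "f k \<bullet> f l = 0" if "k \<in> ?E" "l \<in> ?E" "k \<noteq> l" for k l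
  proof -
    have "f k \<bullet> (P *v f l) = (P *v f k) \<bullet> f l"
      using assms by (metis dot_lmul_matrix transpose_matrix_vector)
    then show ?thesis
      using f that by auto
  qed
  have "inj_on f ?E"
    by (rule inj_onI) (metis f inner_eq_zero_iff mem_Collect_eq orth)
  moreover have "finite (f ` ?E)"
  proof (rule independent_imp_finite, rule pairwise_orthogonal_independent)
    show "pairwise orthogonal (f ` ?E)"
      unfolding pairwise_def orthogonal_def using orth by auto
    show "0 \<notin> f ` ?E"
      using f by force
  qed
  ultimately show ?thesis
    by (rule finite_imageD[rotated])
qed

lemma lambda_max_bound:
  fixes P :: "real^'n^'n"
  assumes "transpose P = P"
  shows "x \<bullet> (P *v x) \<le> lambda_max P * (x \<bullet> x)"
proof -
  obtain v m where v: "norm v = 1" "P *v v = m *\<^sub>R (mat 1 *v v)"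
    and le: "\<And>x. x \<bullet> (P *v x) \<le> m * (x \<bullet> (mat 1 *v x))"
    using generalized_Rayleigh[of P "mat 1"] assms by (metis inner_gt_zero_iff matrix_vector_mul_lid transpose_mat)
  have "is_eigenvalue P m"
    unfolding is_eigenvalue_def using v by (intro exI[of _ v]) auto
  then have "m \<le> lambda_max P"
    unfolding lambda_max_def using finite_eigenvalues[OF assms] by simp
  then have "m * (x \<bullet> x) \<le> lambda_max P * (x \<bullet> x)"
    by (simp add: mult_right_mono)
  with le[of x] show ?thesis by simp
qed

text \<open>The Rayleigh quotient of \<open>- P\<close> is maximised. The eigenvalue so produced
  also shows that the set under \<open>Min\<close> is nonempty, so \<open>lambda_min P\<close> is
  attained.\<close>

lemma lambda_min_bound:
  fixes P :: "real^'n^'n"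
  assumes "transpose P = P"
  shows "lambda_min P * (x \<bullet> x) \<le> x \<bullet> (P *v x)"
    and "is_eigenvalue P (lambda_min P)"
proof -
  have "transpose (- P) = - P"
    using assms by (simp add: transpose_def vec_eq_iff)
  then obtain v m where v: "norm v = 1" "(- P) *v v = m *\<^sub>R (mat 1 *v v)"
    and le: "\<And>x. x \<bullet> ((- P) *v x) \<le> m * (x \<bullet> (mat 1 *v x))"
    using generalized_Rayleigh[of "- P" "mat 1"] by (metis inner_gt_zero_iff matrix_vector_mul_lid transpose_mat)
  have neg: "(- P) *v x = - (P *v x)" for x
    using matrix_vector_mult_diff_rdistrib[of 0 P x] by simp
  have "P *v v = (- m) *\<^sub>R v"
    using v(2) neg[of v] by (metis matrix_vector_mul_lid minus_minus scaleR_minus_left)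
  then have eig: "is_eigenvalue P (- m)"
    unfolding is_eigenvalue_def using v(1) by (intro exI[of _ v]) auto
  then have "lambda_min P \<le> - m"
    unfolding lambda_min_def using finite_eigenvalues[OF assms] by simp
  then have "lambda_min P * (x \<bullet> x) \<le> - m * (x \<bullet> x)"
    by (rule mult_right_mono) simp
  with le[of x] show "lambda_min P * (x \<bullet> x) \<le> x \<bullet> (P *v x)"
    by (simp add: neg)
  show "is_eigenvalue P (lambda_min P)"
    unfolding lambda_min_def using finite_eigenvalues[OF assms] eig Min_in[of "{l. is_eigenvalue P l}"]
    by blast
qed

lemma lambda_min_pos:
  fixes P :: "real^'n^'n"
  assumes P: "transpose P = P" and pos: "\<And>x. x \<noteq> 0 \<Longrightarrow> 0 < x \<bullet> (P *v x)"
  shows "0 < lambda_min P"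
proof -
  obtain v where v: "v \<noteq> 0" "P *v v = lambda_min P *\<^sub>R v"
    using lambda_min_bound(2)[OF P] unfolding is_eigenvalue_def by blast
  then have "0 < lambda_min P * (v \<bullet> v)"
    using pos[of v] by simp
  then show ?thesis
    by (rule zero_less_mult_pos2) (use v in simp)
qed

section \<open>Contraction in the norm of \<open>P\<close> from samples\<close>

text \<open>The form at \<open>x - y\<close> is at most
  \<open>lambda_max P * (2 * (1 - x \<bullet> y))\<close>; expand it and use
  \<open>2 * a * b \<le> a\<^sup>2 + b\<^sup>2\<close>. The condition number enters through
  \<open>lambda_max P = kappa P * lambda_min P \<le> kappa P * (a * b)\<close>.\<close>

lemma P_angle_bound:
  fixes P :: "real^'n^'n"
  assumes P: "transpose P = P" and pos: "\<And>x. x \<noteq> 0 \<Longrightarrow> 0 < x \<bullet> (P *v x)"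
    and xy: "norm x = 1" "norm y = 1" and c: "c \<le> x \<bullet> y" "c \<le> 1"
  shows "(1 - kappa P * (1 - c)) * (sqrt (x \<bullet> (P *v x)) * sqrt (y \<bullet> (P *v y))) \<le> y \<bullet> (P *v x)"
proof -
  define a b where "a = sqrt (x \<bullet> (P *v x))" and "b = sqrt (y \<bullet> (P *v y))"
  have l: "0 < lambda_min P"
    using lambda_min_pos[OF P pos] .
  have "x \<noteq> 0" "y \<noteq> 0"
    using xy by auto
  then have "x \<bullet> (P *v x) > 0" "y \<bullet> (P *v y) > 0"
    using pos by auto
  then have a2: "a\<^sup>2 = x \<bullet> (P *v x)" and b2: "b\<^sup>2 = y \<bullet> (P *v y)" and ab0: "0 \<le> a" "0 \<le> b"
    by (simp_all add: a_def b_def)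
  have xx: "x \<bullet> x = 1" "y \<bullet> y = 1"
    using xy by (simp_all add: norm_eq_1)
  have "sqrt (lambda_min P) \<le> a" "sqrt (lambda_min P) \<le> b"
    using lambda_min_bound(1)[OF P, of x] lambda_min_bound(1)[OF P, of y] xx
    by (simp_all add: a_def b_def)
  then have "sqrt (lambda_min P) * sqrt (lambda_min P) \<le> a * b"
    using l ab0 by (intro mult_mono) auto
  then have lab: "lambda_min P \<le> a * b"
    using l by simp
  have sym: "x \<bullet> (P *v y) = y \<bullet> (P *v x)"
    using P by (metis dot_lmul_matrix inner_commute transpose_matrix_vector)
  have "a\<^sup>2 + b\<^sup>2 - 2 * (y \<bullet> (P *v x)) = (x - y) \<bullet> (P *v (x - y))"
    by (simp add: a2 b2 sym algebra_simps matrix_vector_mult_diff_distrib inner_diff_left inner_diff_right)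
  also have "\<dots> \<le> lambda_max P * ((x - y) \<bullet> (x - y))"
    by (rule lambda_max_bound[OF P])
  also have "(x - y) \<bullet> (x - y) = 2 * (1 - x \<bullet> y)"
    using xx by (simp add: algebra_simps inner_commute)
  finally have 1: "a\<^sup>2 + b\<^sup>2 - 2 * (y \<bullet> (P *v x)) \<le> lambda_max P * (2 * (1 - x \<bullet> y))" .
  have "lambda_max P \<ge> 0"
    using lambda_max_bound[OF P, of x] xx \<open>x \<bullet> (P *v x) > 0\<close> by simp
  then have "lambda_max P * (2 * (1 - x \<bullet> y)) \<le> 2 * (lambda_max P * (1 - c))"
    using mult_left_mono[OF c(1), of "lambda_max P"] by (simp add: algebra_simps)
  moreover have "0 \<le> (a - b)\<^sup>2" by simp
  ultimately have 2: "a * b - lambda_max P * (1 - c) \<le> y \<bullet> (P *v x)"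
    using 1 by (simp add: power2_diff)
  have "lambda_max P = kappa P * lambda_min P" and "0 \<le> kappa P"
    using l \<open>lambda_max P \<ge> 0\<close> by (simp_all add: kappa_def)
  then have "lambda_max P \<le> kappa P * (a * b)"
    using lab by (simp add: mult_left_mono)
  then have "lambda_max P * (1 - c) \<le> kappa P * (a * b) * (1 - c)"
    using c by (simp add: mult_right_mono)
  with 2 show ?thesis
    by (simp add: a_def[symmetric] b_def[symmetric] algebra_simps)
qed

text \<open>The maximiser \<open>v\<close> satisfies \<open>F *v v = m *\<^sub>R (P *v v)\<close>,
  so Cauchy-Schwarz for \<open>F\<close> at \<open>v\<close> and \<open>y\<close> bounds
  \<open>m\<close> by the quotient at \<open>y\<close> over the squared \<open>P\<close>-cosine. A
  single sample near \<open>v\<close> thus controls the form everywhere.\<close>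

lemma contraction_from_samples:
  fixes P C :: "real^'n^'n"
  assumes P: "transpose P = P" and pos: "\<And>x. x \<noteq> 0 \<Longrightarrow> 0 < x \<bullet> (P *v x)"
    and c: "c \<le> 1" "kappa P * (1 - c) < 1"
    and net: "\<And>x. norm x = 1 \<Longrightarrow> \<exists>y. norm y = 1 \<and> c \<le> \<bar>x \<bullet> y\<bar> \<and>
        (C *v y) \<bullet> (P *v (C *v y)) \<le> g\<^sup>2 * (y \<bullet> (P *v y))"
  shows "(C *v x) \<bullet> (P *v (C *v x)) \<le> (g / (1 - kappa P * (1 - c)))\<^sup>2 * (x \<bullet> (P *v x))"
proof -
  define d where "d = 1 - kappa P * (1 - c)"
  have d: "0 < d" using c by (simp add: d_def)
  define F where "F = transpose C ** P ** C"
  have F: "y \<bullet> (F *v z) = (C *v y) \<bullet> (P *v (C *v z))" for y z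
    by (metis F_def dot_lmul_matrix matrix_vector_mul_assoc transpose_matrix_vector transpose_transpose)
  have symF: "transpose F = F"
    by (simp add: F_def matrix_transpose_mul P matrix_mul_assoc)
  have nonneg: "0 \<le> z \<bullet> (P *v z)" for z
    using pos[of z] by (cases "z = 0") auto
  have "psd F"
    by (simp add: psd_def symF F nonneg)
  obtain v m where v: "norm v = 1" "F *v v = m *\<^sub>R (P *v v)"
    and le: "\<And>x. x \<bullet> (F *v x) \<le> m * (x \<bullet> (P *v x))"
    using generalized_Rayleigh[OF symF P pos] by blast
  have Pv: "0 < v \<bullet> (P *v v)"
    by (rule pos) (use v in auto)
  have Fv: "v \<bullet> (F *v v) = m * (v \<bullet> (P *v v))"
    using v by simp
  have m0: "0 \<le> m"
    using Fv Pv nonneg[of "C *v v"] by (simp add: F zero_le_mult_iff)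
  obtain y0 where y0: "norm y0 = 1" "c \<le> \<bar>v \<bullet> y0\<bar>"
      "(C *v y0) \<bullet> (P *v (C *v y0)) \<le> g\<^sup>2 * (y0 \<bullet> (P *v y0))"
    using net[OF v(1)] by blast
  \<comment> \<open>The net is only up to sign; both forms are even, so the sample may be
    reflected.\<close>
  define y where "y = (if 0 \<le> v \<bullet> y0 then y0 else - y0)"
  have y: "norm y = 1" "c \<le> v \<bullet> y" "y \<bullet> (F *v y) \<le> g\<^sup>2 * (y \<bullet> (P *v y))"
    using y0 by (auto simp: y_def F abs_if linear_neg[OF matrix_vector_mul_linear])
  have Py: "0 < y \<bullet> (P *v y)"
    by (rule pos) (use y in auto)
  let ?s = "sqrt (v \<bullet> (P *v v)) * sqrt (y \<bullet> (P *v y))"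
  have "d * ?s \<le> y \<bullet> (P *v v)"
    unfolding d_def by (rule P_angle_bound[OF P pos v(1) y(1) y(2) c(1)])
  then have "(d * ?s)\<^sup>2 \<le> (y \<bullet> (P *v v))\<^sup>2"
    using d Pv Py by (intro power_mono) auto
  then have *: "d\<^sup>2 * ((v \<bullet> (P *v v)) * (y \<bullet> (P *v y))) \<le> (y \<bullet> (P *v v))\<^sup>2"
    using Pv Py by (simp add: power_mult_distrib)
  \<comment> \<open>The factor \<open>m\<^sup>2\<close> turns \<open>y \<bullet> (P *v v)\<close>
    into \<open>y \<bullet> (F *v v)\<close> by the eigenvector equation.\<close>
  have "m\<^sup>2 * (d\<^sup>2 * ((v \<bullet> (P *v v)) * (y \<bullet> (P *v y)))) \<le> m\<^sup>2 * (y \<bullet> (P *v v))\<^sup>2"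
    by (rule mult_left_mono[OF *]) simp
  also have "\<dots> = (y \<bullet> (F *v v))\<^sup>2"
    using v by (simp add: power_mult_distrib)
  also have "\<dots> \<le> (y \<bullet> (F *v y)) * (v \<bullet> (F *v v))"
    by (rule psd_Cauchy_Schwarz[OF \<open>psd F\<close>])
  also have "\<dots> \<le> (g\<^sup>2 * (y \<bullet> (P *v y))) * (m * (v \<bullet> (P *v v)))"
    unfolding Fv using y(3) m0 Pv by (intro mult_right_mono) auto
  finally have "(m * (m * d\<^sup>2)) * ((v \<bullet> (P *v v)) * (y \<bullet> (P *v y)))
      \<le> (m * g\<^sup>2) * ((v \<bullet> (P *v v)) * (y \<bullet> (P *v y)))"
    by (simp add: power2_eq_square mult_ac)
  then have "m * (m * d\<^sup>2) \<le> m * g\<^sup>2"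
    using Pv Py by (simp add: mult_le_cancel_right)
  then have "m * d\<^sup>2 \<le> g\<^sup>2"
    using m0 by (cases "m = 0") auto
  then have "m \<le> (g / d)\<^sup>2"
    using d by (simp add: power_divide field_simps)
  then have "m * (x \<bullet> (P *v x)) \<le> (g / d)\<^sup>2 * (x \<bullet> (P *v x))"
    using nonneg by (rule mult_right_mono)
  with le[of x] show ?thesis
    by (simp add: F d_def)
qed

section \<open>Growth rates and the joint spectral radius\<close>

lemma root_growth_bound:
  assumes "0 \<le> (a::real)" "a \<le> C * r ^ k" "0 < C" "0 \<le> r" "0 < k"
  shows "a powr (1 / real k) \<le> C powr (1 / real k) * r"
proof -
  have "a powr (1 / real k) \<le> (C * r ^ k) powr (1 / real k)"
    using assms by (intro powr_mono2) auto
  also have "\<dots> = C powr (1 / real k) * (r ^ k) powr (1 / real k)"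
    using assms by (simp add: powr_mult)
  also have "(r ^ k) powr (1 / real k) = r"
    using assms by (cases "r = 0") (auto simp: powr_realpow[symmetric] powr_powr)
  finally show ?thesis .
qed

lemma powr_inverse_tendsto_1:
  assumes "0 < (C::real)"
  shows "(\<lambda>k. C powr (1 / real k)) \<longlonglongrightarrow> 1"
proof -
  have "(\<lambda>k. C powr (1 / real k)) \<longlonglongrightarrow> C powr 0"
    by (rule tendsto_powr[OF tendsto_const lim_1_over_n]) (use assms in auto)
  then show ?thesis using assms by simp
qed

text \<open>Fekete's argument in multiplicative form, with the infimum of the roots as limit.
  Convergence matters because \<open>jsr\<close> is given by \<open>lim\<close>, which says nothing
  about a divergent sequence.\<close>

lemma submultiplicative_root_convergent:
  fixes a :: "nat \<Rightarrow> real"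
  assumes a0: "\<And>k. 0 \<le> a k" and sub: "\<And>k l. a (k + l) \<le> a k * a l"
  shows "convergent (\<lambda>k. a k powr (1 / real k))"
proof -
  define b where "b = (\<lambda>k. a k powr (1 / real k))"
  \<comment> \<open>Index \<open>0\<close> is left out: \<open>1 / real 0\<close> is
    \<open>0\<close>, so \<open>b 0\<close> carries no information on growth.\<close>
  define L where "L = Inf (b ` {1..})"
  have bdd: "bdd_below (b ` {1..})"
    by (rule bdd_belowI[of _ 0]) (auto simp: b_def)
  have Lb: "L \<le> b k" if "1 \<le> k" for k
    unfolding L_def using bdd that by (intro cInf_lower) auto
  have L0: "0 \<le> L"
    unfolding L_def by (intro cInf_greatest) (auto simp: b_def)
  have "b \<longlonglongrightarrow> L"
  proof (rule order_tendstoI)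
    fix r assume "r < L"
    then show "\<forall>\<^sub>F k in sequentially. r < b k"
      using Lb by (intro eventually_sequentiallyI[of 1]) (meson less_le_trans)
  next
    fix r' assume "L < r'"
    \<comment> \<open>The gap between \<open>r\<close> and \<open>r'\<close> will absorb the factor
      \<open>C powr (1 / real k)\<close>.\<close>
    then obtain r where r: "L < r" "r < r'" using dense by blast
    have r0: "0 < r" using L0 r by simp
    obtain m where m: "1 \<le> m" "b m < r"
      using cInf_lessD[of "b ` {1..}" r] r(1) unfolding L_def by auto
    have am: "a m \<le> r ^ m"
    proof -
      have "a m = b m powr real m"
        using m a0[of m] by (simp add: b_def powr_powr)
      also have "\<dots> \<le> r powr real m"
        using m by (intro powr_mono2) (auto simp: b_def)
      finally show ?thesis using r0 by (simp add: powr_realpow)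
    qed
    \<comment> \<open>One constant for all remainders \<open>s < m\<close>; the summand
      \<open>1\<close> makes it positive.\<close>
    define C where "C = 1 + (\<Sum>s<m. a s / r ^ s)"
    have C: "0 < C"
      unfolding C_def using a0 r0 by (intro add_pos_nonneg sum_nonneg) auto
    have as: "a s \<le> C * r ^ s" if "s < m" for s
    proof -
      have "a s / r ^ s \<le> (\<Sum>s<m. a s / r ^ s)"
        using that a0 r0 by (intro member_le_sum) auto
      then show ?thesis
        using r0 by (simp add: C_def pos_divide_le_eq[symmetric])
    qed
    have growth_aux: "a (q * m + s) \<le> C * r ^ (q * m + s)" if "s < m" for q s
    proof (induction q)
      case 0
      then show ?case using as[OF that] by simp
    next
      case (Suc q)
      have "a (Suc q * m + s) \<le> a m * a (q * m + s)"
        using sub[of m "q * m + s"] by (simp add: add_ac)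
      also have "\<dots> \<le> r ^ m * (C * r ^ (q * m + s))"
        using Suc am a0 r0 by (intro mult_mono) auto
      finally show ?case by (simp add: power_add mult_ac)
    qed
    have growth: "a k \<le> C * r ^ k" for k
      using growth_aux[of "k mod m" "k div m"] m by simp
    have "(\<lambda>k. C powr (1 / real k) * r) \<longlonglongrightarrow> 1 * r"
      by (intro tendsto_intros powr_inverse_tendsto_1 C)
    then have "\<forall>\<^sub>F k in sequentially. C powr (1 / real k) * r < r'"
      using r by (simp add: order_tendstoD)
    then show "\<forall>\<^sub>F k in sequentially. b k < r'"
      using eventually_gt_at_top[of 0]
    proof eventually_elim
      case (elim k)
      then show ?case
        using root_growth_bound[OF a0 growth C, of k] r0 by (simp add: b_def)
    qed
  qed
  then show ?thesis
    unfolding b_def convergent_def by blast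
qed

text \<open>Later modes act from the left, so the two blocks swap; submultiplicativity of the norms
  rests on this.\<close>

lemma sw_prod_append: "sw_prod F (s @ t) = sw_prod F t ** sw_prod F s"
proof (induction t rule: rev_induct)
  case Nil
  then show ?case by (simp add: sw_prod_def)
next
  case (snoc i t)
  then show ?case
    by (simp add: sw_prod_def matrix_mul_assoc flip: append_assoc)
qed

lemma sw_prod_contraction:
  fixes P :: "real^'n^'n"
  assumes "\<And>i x. i \<in> I \<Longrightarrow> (F i *v x) \<bullet> (P *v (F i *v x)) \<le> r\<^sup>2 * (x \<bullet> (P *v x))"
    and "set s \<subseteq> I"
  shows "(sw_prod F s *v x) \<bullet> (P *v (sw_prod F s *v x)) \<le> (r ^ length s)\<^sup>2 * (x \<bullet> (P *v x))"
  using assms(2)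
proof (induction s rule: rev_induct)
  case Nil
  then show ?case by (simp add: sw_prod_def)
next
  case (snoc i s)
  let ?y = "sw_prod F s *v x"
  have "sw_prod F (s @ [i]) *v x = F i *v ?y"
    by (simp add: sw_prod_def matrix_vector_mul_assoc)
  moreover have "(F i *v ?y) \<bullet> (P *v (F i *v ?y)) \<le> r\<^sup>2 * (?y \<bullet> (P *v ?y))"
    using snoc.prems by (intro assms(1)) simp
  moreover have "r\<^sup>2 * (?y \<bullet> (P *v ?y)) \<le> r\<^sup>2 * ((r ^ length s)\<^sup>2 * (x \<bullet> (P *v x)))"
    using snoc by (intro mult_left_mono) auto
  ultimately show ?case
    by (simp add: power_mult_distrib mult_ac)
qed

text \<open>Passing between the Euclidean norm and that of \<open>P\<close> costs a factor
  independent of the word length. Products of length \<open>k\<close> thus have norm at most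
  \<open>C * r ^ k\<close>, and the root of \<open>C\<close> tends to \<open>1\<close>.\<close>

lemma jsr_le:
  fixes P :: "real^'n^'n"
  assumes I: "finite I" "I \<noteq> {}" and r: "0 \<le> r"
    and P: "transpose P = P" and pos: "\<And>x. x \<noteq> 0 \<Longrightarrow> 0 < x \<bullet> (P *v x)"
    and contr: "\<And>i x. i \<in> I \<Longrightarrow> (F i *v x) \<bullet> (P *v (F i *v x)) \<le> r\<^sup>2 * (x \<bullet> (P *v x))"
  shows "jsr F I \<le> r"
proof -
  define W where "W k = {s. length s = k \<and> set s \<subseteq> I}" for k
  define f where "f s = onorm (\<lambda>x. sw_prod F s *v x)" for s
  define a where "a k = Max (f ` W k)" for k
  have finW: "finite (W k)" for k
    using finite_lists_length_eq[OF I(1), of k] unfolding W_def by (rule back_subst) auto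
  obtain i where "i \<in> I" using I by blast
  then have "replicate k i \<in> W k" for k
    by (auto simp: W_def)
  then have neW: "W k \<noteq> {}" for k by blast
  have bl: "bounded_linear (\<lambda>x. sw_prod F s *v x)" for s
    by (rule matrix_vector_mul_bounded_linear)
  have f0: "0 \<le> f s" for s
    unfolding f_def by (rule onorm_pos_le[OF bl])
  have fa: "f s \<le> a k" if "s \<in> W k" for s k
    unfolding a_def using that finW by simp
  have att: "\<exists>s\<in>W k. a k = f s" for k
    using Max_in[of "f ` W k"] finW neW unfolding a_def by fastforce
  have a0: "0 \<le> a k" for k
    using att[of k] f0 by auto
  have sub: "a (k + l) \<le> a k * a l" for k l
  proof -
    obtain s where s: "s \<in> W (k + l)" "a (k + l) = f s"
      using att by blast
    let ?u = "take k s" and ?v = "drop k s"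
    have uv: "?u \<in> W k" "?v \<in> W l"
      using s(1) set_take_subset[of k s] set_drop_subset[of k s] by (auto simp: W_def)
    have "sw_prod F s = sw_prod F ?v ** sw_prod F ?u"
      by (metis append_take_drop_id sw_prod_append)
    then have "f s = onorm ((\<lambda>x. sw_prod F ?v *v x) \<circ> (\<lambda>x. sw_prod F ?u *v x))"
      by (simp add: f_def matrix_vector_mul_assoc o_def)
    also have "\<dots> \<le> f ?v * f ?u"
      unfolding f_def by (rule onorm_compose[OF bl bl])
    also have "\<dots> \<le> a l * a k"
      using uv by (intro mult_mono fa a0 f0)
    finally show ?thesis using s by (simp add: mult.commute)
  qed
  \<comment> \<open>\<open>jsr\<close> takes roots before the maximum, while \<open>a\<close> takes
    the maximum first; monotonicity of the root reconciles them.\<close>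
  have Max_powr: "Max ((\<lambda>s. f s powr (1 / real k)) ` W k) = a k powr (1 / real k)" for k
  proof (rule Max_eqI)
    show "finite ((\<lambda>s. f s powr (1 / real k)) ` W k)"
      using finW by simp
    show "y \<le> a k powr (1 / real k)" if "y \<in> (\<lambda>s. f s powr (1 / real k)) ` W k" for y
      using that fa f0 by (auto intro!: powr_mono2)
    show "a k powr (1 / real k) \<in> (\<lambda>s. f s powr (1 / real k)) ` W k"
      using att[of k] by auto
  qed
  let ?b = "\<lambda>k. a k powr (1 / real k)"
  have jsr: "jsr F I = lim ?b"
    unfolding jsr_def using Max_powr by (simp add: W_def f_def)
  have lim: "?b \<longlonglongrightarrow> lim ?b"
    using submultiplicative_root_convergent[of a, OF a0 sub] by (simp add: convergent_LIMSEQ_iff)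
  have l: "0 < lambda_min P" using lambda_min_pos[OF P pos] .
  \<comment> \<open>The product of the two constants that compare the Euclidean norm with that of
    \<open>P\<close>.\<close>
  define C where "C = sqrt (lambda_max P / lambda_min P)"
  have "lambda_max P > 0"
  proof -
    obtain v :: "real^'n" where v: "norm v = 1" using vector_choose_size[of 1] by auto
    then have "v \<noteq> 0" by auto
    then show ?thesis
      using pos[of v] lambda_max_bound[OF P, of v] v by (simp add: norm_eq_1)
  qed
  then have C: "0 < C"
    using l by (simp add: C_def)
  have growth: "a k \<le> C * r ^ k" for k
  proof -
    obtain s where s: "s \<in> W k" "a k = f s"
      using att by blast
    have "norm (sw_prod F s *v x) \<le> (C * r ^ k) * norm x" for x
    proof -
      let ?y = "sw_prod F s *v x"
      have "lambda_min P * (?y \<bullet> ?y) \<le> ?y \<bullet> (P *v ?y)"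
        by (rule lambda_min_bound(1)[OF P])
      also have "\<dots> \<le> (r ^ k)\<^sup>2 * (x \<bullet> (P *v x))"
        using sw_prod_contraction[of I F P r s, OF contr] s(1) by (simp add: W_def)
      also have "\<dots> \<le> (r ^ k)\<^sup>2 * (lambda_max P * (x \<bullet> x))"
        by (intro mult_left_mono lambda_max_bound[OF P]) simp
      finally have "(norm ?y)\<^sup>2 \<le> (lambda_max P / lambda_min P) * ((r ^ k)\<^sup>2 * (norm x)\<^sup>2)"
        using l by (simp add: power2_norm_eq_inner field_simps)
      also have "\<dots> = ((C * r ^ k) * norm x)\<^sup>2"
        using \<open>lambda_max P > 0\<close> l by (simp add: C_def power_mult_distrib)
      finally show ?thesis
        using C r by (intro power2_le_imp_le[of "norm ?y"]) auto
    qed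
    then show ?thesis
      unfolding s(2) f_def by (rule onorm_le)
  qed
  have "(\<lambda>k. C powr (1 / real k) * r) \<longlonglongrightarrow> 1 * r"
    by (intro tendsto_intros powr_inverse_tendsto_1 C)
  moreover have "\<exists>N. \<forall>k\<ge>N. ?b k \<le> C powr (1 / real k) * r"
    using root_growth_bound[OF a0 growth C r] by (intro exI[of _ 1]) auto
  ultimately show ?thesis
    unfolding jsr using lim by (simp add: LIMSEQ_le)
qed

section \<open>Feasibility of the output of the algorithm\<close>

text \<open>The last K-step supplies the sample inequalities for the final \<open>P\<close> and
  \<open>K\<close>; the P-step before it supplies \<open>psd (P - mat 1)\<close>, hence
  definiteness.\<close>

lemma alg1_output_feasible:
  assumes "alg1_output A B S tol g P K"
  shows "0 \<le> g" "transpose P = P" "\<And>x. x \<noteq> 0 \<Longrightarrow> 0 < x \<bullet> (P *v x)"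
    and "\<And>x i. (x, i) \<in> S \<Longrightarrow>
      ((A i + B ** K) *v x) \<bullet> (P *v ((A i + B ** K) *v x)) \<le> g\<^sup>2 * (x \<bullet> (P *v x))"
proof -
  have K: "Kstep_feas A B S P g K" and PI: "psd (P - mat 1)"
    using assms unfolding alg1_output_def Kstep_sol_def Pstep_sol_def Pstep_feas_def by blast+
  from K show "0 \<le> g" by (simp add: Kstep_feas_def)
  have "transpose (P - mat 1) = transpose P - mat 1"
    by (simp add: transpose_def vec_eq_iff mat_def eq_commute)
  with PI show "transpose P = P" by (simp add: psd_def)
  show "0 < x \<bullet> (P *v x)" if "x \<noteq> 0" for x
  proof -
    have "x \<bullet> x \<le> x \<bullet> (P *v x)"
      using PI by (simp add: psd_def matrix_vector_mult_diff_rdistrib inner_diff_right)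
    then show ?thesis using that inner_gt_zero_iff[of x] by linarith
  qed
  show "((A i + B ** K) *v x) \<bullet> (P *v ((A i + B ** K) *v x)) \<le> g\<^sup>2 * (x \<bullet> (P *v x))"
    if "(x, i) \<in> S" for x i
  proof -
    define y where "y = A i *v x + B *v (K *v x)"
    have y: "(A i + B ** K) *v x = y"
      by (simp add: y_def matrix_vector_mult_add_rdistrib matrix_vector_mul_assoc)
    have "0 \<le> t\<^sup>2 * g\<^sup>2 * (x \<bullet> (P *v x)) + 2 * t * (z \<bullet> (P *v y)) + z \<bullet> (P *v z)" for t z
      using K that unfolding Kstep_feas_def Let_def y_def by blast
    \<comment> \<open>Schur complement: at \<open>t = 1\<close>, \<open>z = - y\<close> the block
      form is the difference of the two sides.\<close>
    from this[of 1 "- y"] show ?thesis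
      by (simp add: y linear_neg[OF matrix_vector_mul_linear])
  qed
qed

section \<open>The uniform measure on the sphere\<close>

lemma measure_unit_ball_pos: "0 < measure lebesgue (ball 0 1 :: (real^'n) set)"
  using content_ball_pos[of 1 "0 :: real^'n"] by (simp add: measure_completion)

lemma unit_ball_emeasure:
  "emeasure lborel (ball 0 1 :: (real^'n) set) \<noteq> 0"
  "emeasure lborel (ball 0 1 :: (real^'n) set) \<noteq> \<infinity>"
  using content_ball_pos[of 1 "0 :: real^'n"] emeasure_lborel_ball_finite[of "0 :: real^'n" 1]
  by (auto simp: measure_def)

lemma prob_space_unif_sphere: "prob_space (unif_sphere :: (real^'n) measure)"
  unfolding unif_sphere_def
  by (intro prob_space.prob_space_distr prob_space_uniform_measure unit_ball_emeasure) simp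

lemma sets_unif_sphere [measurable_cong, simp]: "sets (unif_sphere :: (real^'n) measure) = sets borel"
  and space_unif_sphere [simp]: "space (unif_sphere :: (real^'n) measure) = UNIV"
  by (simp_all add: unif_sphere_def)

lemma measure_unif_sphere:
  fixes A :: "(real^'n) set"
  assumes [measurable]: "A \<in> sets borel"
  shows "measure unif_sphere A =
    measure lebesgue (ball 0 1 \<inter> sgn -` A) / measure lebesgue (ball 0 1 :: (real^'n) set)"
proof -
  have [measurable]: "sgn -` A \<in> sets borel"
    using measurable_sets[OF borel_measurable_sgn assms] by simp
  have "measure unif_sphere A = measure (uniform_measure lborel (ball 0 1)) (sgn -` A)"
    unfolding unif_sphere_def by (subst measure_distr) simp_all
  also have "\<dots> = measure lborel (ball 0 1 \<inter> sgn -` A) / measure lborel (ball 0 1 :: (real^'n) set)"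
    by (rule measure_uniform_measure[OF unit_ball_emeasure]) simp
  finally show ?thesis
    by (simp add: measure_completion)
qed

lemma cone_lmeasurable:
  fixes A :: "(real^'n) set"
  assumes "A \<in> sets borel"
  shows "ball 0 1 \<inter> sgn -` A \<in> lmeasurable"
proof (rule bounded_set_imp_lmeasurable)
  show "bounded (ball 0 1 \<inter> sgn -` A)"
    by (intro bounded_Int) simp
  have "sgn -` A \<in> sets borel"
    using measurable_sets[OF borel_measurable_sgn assms] by simp
  then show "ball 0 1 \<inter> sgn -` A \<in> sets lebesgue"
    by (intro sets_completionI_sets) simp
qed

section \<open>Rotation invariance\<close>

text \<open>The Jacobian factor \<open>\<bar>s\<bar> ^ DIM('a)\<close> is \<open>1\<close>. The
  values \<open>1\<close> and \<open>-1\<close> of \<open>s\<close> serve for translations and for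
  the maps from \<open>x\<close> to \<open>c - x\<close>.\<close>

lemma nn_integral_lborel_isometric_affine:
  fixes t :: "'a::euclidean_space"
  assumes [measurable]: "g \<in> borel_measurable borel" and s: "\<bar>s\<bar> = 1"
  shows "(\<integral>\<^sup>+x. g (t + s *\<^sub>R x) \<partial>lborel) = (\<integral>\<^sup>+x. g x \<partial>lborel)"
proof -
  have "s \<noteq> 0" using s by auto
  have "(\<integral>\<^sup>+x. g x \<partial>lborel)
      = (\<integral>\<^sup>+x. g x \<partial>density (distr lborel borel (\<lambda>x. t + s *\<^sub>R x)) (\<lambda>_. \<bar>s\<bar> ^ DIM('a)))"
    using lborel_affine[OF \<open>s \<noteq> 0\<close>, of t] by simp
  also have "\<dots> = (\<integral>\<^sup>+x. g (t + s *\<^sub>R x) \<partial>lborel)"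
    by (simp add: s nn_integral_density nn_integral_distr)
  finally show ?thesis by simp
qed

lemma nn_integral_lborel_add:
  fixes c :: "'a::euclidean_space"
  assumes "g \<in> borel_measurable borel"
  shows "(\<integral>\<^sup>+x. g (c + x) \<partial>lborel) = (\<integral>\<^sup>+x. g x \<partial>lborel)"
  using nn_integral_lborel_isometric_affine[OF assms, of 1 c] by simp

lemma nn_integral_lborel_diff:
  fixes c :: "'a::euclidean_space"
  assumes "g \<in> borel_measurable borel"
  shows "(\<integral>\<^sup>+x. g (c - x) \<partial>lborel) = (\<integral>\<^sup>+x. g x \<partial>lborel)"
  using nn_integral_lborel_isometric_affine[OF assms, of "-1" c] by simp

text \<open>Uniqueness of translation-invariant measures, in the style of Weil: compare
  \<open>\<integral>\<integral> g (f y) 1\<^sub>C x\<close> and \<open>\<integral>\<integral> g x 1\<^sub>C (f y)\<close> for the unit ball \<open>C\<close> by Fubini. (The library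
  has orthogonal invariance only over well-ordered index types.)\<close>

lemma nn_integral_lborel_orthogonal:
  fixes f :: "'a::euclidean_space \<Rightarrow> 'a"
  assumes f: "orthogonal_transformation f" and g[measurable]: "g \<in> borel_measurable borel"
  shows "(\<integral>\<^sup>+x. g (f x) \<partial>lborel) = (\<integral>\<^sup>+x. g x \<partial>lborel)"
proof -
  have "continuous_on UNIV f"
    by (intro linear_continuous_on linear_conv_bounded_linear[THEN iffD1]
        orthogonal_transformation_linear f)
  then have [measurable]: "f \<in> borel_measurable borel"
    by (rule borel_measurable_continuous_onI)
  obtain h where h: "\<And>x. f (h x) = x"
    using orthogonal_transformation_surj[OF f] by (metis surj_f_inv_f)
  let ?C = "ball 0 1 :: 'a set"
  have C[measurable]: "(indicator ?C :: 'a \<Rightarrow> ennreal) \<in> borel_measurable borel"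
    by (rule borel_measurable_indicator) simp
  have ind: "indicator ?C (f y) = (indicator ?C y :: ennreal)" for y
    using f by (simp add: indicator_def orthogonal_transformation_norm)
  have "(\<integral>\<^sup>+y. g (f y) \<partial>lborel) * emeasure lborel ?C
      = (\<integral>\<^sup>+y. g (f y) * (\<integral>\<^sup>+x. indicator ?C x \<partial>lborel) \<partial>lborel)"
    by (simp add: nn_integral_multc)
  also have "\<dots> = (\<integral>\<^sup>+y. g (f y) * (\<integral>\<^sup>+x. indicator ?C (f y + x) \<partial>lborel) \<partial>lborel)"
    by (simp only: nn_integral_lborel_add[OF C])
  also have "\<dots> = (\<integral>\<^sup>+y. (\<integral>\<^sup>+x. g (f y) * indicator ?C (f y + x) \<partial>lborel) \<partial>lborel)"
    by (intro nn_integral_cong nn_integral_cmult[symmetric]) measurable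
  also have "\<dots> = (\<integral>\<^sup>+x. (\<integral>\<^sup>+y. g (f y) * indicator ?C (f y + x) \<partial>lborel) \<partial>lborel)"
    by (rule lborel_pair.Fubini') measurable
  also have "\<dots> = (\<integral>\<^sup>+x. (\<integral>\<^sup>+y. g (f y - x) * indicator ?C (f y) \<partial>lborel) \<partial>lborel)"
  proof (rule nn_integral_cong)
    fix x
    \<comment> \<open>Translating \<open>y\<close> by a preimage of \<open>- x\<close> moves the
      shift from the ball to \<open>g\<close>.\<close>
    have "f (h (- x) + y) = f y - x" for y
      using f by (simp add: orthogonal_transformation_linear linear_add h)
    then show "(\<integral>\<^sup>+y. g (f y) * indicator ?C (f y + x) \<partial>lborel)
        = (\<integral>\<^sup>+y. g (f y - x) * indicator ?C (f y) \<partial>lborel)"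
      using nn_integral_lborel_add[of "\<lambda>y. g (f y) * indicator ?C (f y + x)" "h (- x)"] by simp
  qed
  also have "\<dots> = (\<integral>\<^sup>+y. (\<integral>\<^sup>+x. g (f y - x) * indicator ?C (f y) \<partial>lborel) \<partial>lborel)"
    by (rule lborel_pair.Fubini'[symmetric]) measurable
  \<comment> \<open>Substituting \<open>f y - x\<close> removes \<open>y\<close> from the inner
    integral, and the ball is invariant under \<open>f\<close>.\<close>
  also have "\<dots> = (\<integral>\<^sup>+y. (\<integral>\<^sup>+x. g x \<partial>lborel) * indicator ?C y \<partial>lborel)"
  proof (rule nn_integral_cong)
    fix y
    have "(\<integral>\<^sup>+x. g (f y - x) * indicator ?C (f y) \<partial>lborel)
        = (\<integral>\<^sup>+x. g (f y - x) \<partial>lborel) * indicator ?C (f y)"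
      by (rule nn_integral_multc) measurable
    then show "(\<integral>\<^sup>+x. g (f y - x) * indicator ?C (f y) \<partial>lborel)
        = (\<integral>\<^sup>+x. g x \<partial>lborel) * indicator ?C y"
      by (simp only: nn_integral_lborel_diff[OF g] ind)
  qed
  also have "\<dots> = (\<integral>\<^sup>+x. g x \<partial>lborel) * emeasure lborel ?C"
    by (rule nn_integral_cmult_indicator) simp
  finally have "emeasure lborel ?C * (\<integral>\<^sup>+x. g (f x) \<partial>lborel) = emeasure lborel ?C * (\<integral>\<^sup>+x. g x \<partial>lborel)"
    by (simp add: mult.commute)
  moreover have "emeasure lborel ?C \<noteq> 0" "emeasure lborel ?C < \<infinity>"
    using emeasure_lborel_ball_finite[of "0::'a" 1] content_ball_pos[of 1 "0::'a"]
    by (auto simp: measure_def)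
  ultimately show ?thesis
    by (auto simp: ennreal_mult_cancel_left)
qed

text \<open>\<open>f\<close> commutes with \<open>sgn\<close> and preserves the unit ball, so the
  cone over the preimage is the preimage of the cone.\<close>

lemma measure_unif_sphere_orthogonal_vimage:
  fixes f :: "real^'n \<Rightarrow> real^'n"
  assumes f: "orthogonal_transformation f" and A: "A \<in> sets borel" "f -` A \<in> sets borel"
  shows "measure unif_sphere (f -` A) = measure unif_sphere A"
proof -
  have [measurable]: "ball 0 1 \<inter> sgn -` B \<in> sets borel" if "B \<in> sets borel" for B :: "(real^'n) set"
    using measurable_sets[OF borel_measurable_sgn that] by auto
  have "sgn (f y) = f (sgn y)" for y
    using f by (simp add: sgn_div_norm orthogonal_transformation_norm
        linear_scale[OF orthogonal_transformation_linear])
  then have "indicator (ball 0 1 \<inter> sgn -` (f -` A)) y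
      = (indicator (ball 0 1 \<inter> sgn -` A) (f y) :: ennreal)" for y
    using f by (simp add: indicator_def orthogonal_transformation_norm)
  then have "emeasure lborel (ball 0 1 \<inter> sgn -` (f -` A)) = emeasure lborel (ball 0 1 \<inter> sgn -` A)"
    using nn_integral_lborel_orthogonal[OF f, of "indicator (ball 0 1 \<inter> sgn -` A)"] A
    by (simp flip: nn_integral_indicator)
  then have "measure lborel (ball 0 1 \<inter> sgn -` (f -` A)) = measure lborel (ball 0 1 \<inter> sgn -` A)"
    by (simp add: measure_def)
  then show ?thesis
    using A by (simp add: measure_unif_sphere measure_completion)
qed

lemma measure_unif_sphere_eq_0:
  fixes A :: "(real^'n) set"
  assumes "A \<in> sets borel" "negligible (ball 0 1 \<inter> sgn -` A)"
  shows "measure unif_sphere A = 0"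
  using assms by (simp add: measure_unif_sphere negligible_imp_measure0)

text \<open>The cone over a nonempty relatively open part of the sphere contains a nonempty open
  set.\<close>

lemma measure_unif_sphere_pos:
  fixes A :: "(real^'n) set"
  assumes A: "A \<in> sets borel" and U: "open U" "U \<inter> sphere 0 1 \<noteq> {}" "U \<inter> sphere 0 1 \<subseteq> A"
  shows "0 < measure unif_sphere A"
proof -
  \<comment> \<open>The origin is removed because \<open>sgn\<close> is discontinuous there.\<close>
  let ?O = "(ball 0 1 - {0}) \<inter> sgn -` U"
  obtain v where v: "v \<in> U" "norm v = 1"
    using U(2) by auto
  have "open ?O"
    by (intro continuous_open_preimage continuous_on_sgn continuous_on_id U(1)) auto
  moreover have "(1/2) *\<^sub>R v \<in> ?O"
    using v by (auto simp: sgn_scaleR) (auto simp: sgn_div_norm)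
  ultimately have "\<not> negligible ?O"
    using open_not_negligible by blast
  moreover have "?O \<subseteq> ball 0 1 \<inter> sgn -` A"
    using U(3) by (auto simp: norm_sgn)
  ultimately have "\<not> negligible (ball 0 1 \<inter> sgn -` A)"
    using negligible_subset by blast
  then have "measure lebesgue (ball 0 1 \<inter> sgn -` A) \<noteq> 0"
    using negligible_iff_measure0[OF cone_lmeasurable[OF A]] by simp
  then show ?thesis
    using A measure_unit_ball_pos[where 'n='n]
    by (simp add: measure_unif_sphere zero_less_divide_iff less_le)
qed

lemma measure_unif_sphere_sphere: "measure unif_sphere (sphere 0 1 :: (real^'n) set) = 1"
proof -
  interpret prob_space "unif_sphere :: (real^'n) measure"
    by (rule prob_space_unif_sphere)
  have "ball 0 1 \<inter> sgn -` (- sphere 0 1) \<subseteq> {0 :: real^'n}"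
    by (auto simp: norm_sgn split: if_splits)
  then have "negligible (ball 0 1 \<inter> sgn -` (- sphere 0 1 :: (real^'n) set))"
    using negligible_subset negligible_sing by blast
  then have "measure unif_sphere (- sphere 0 1 :: (real^'n) set) = 0"
    by (intro measure_unif_sphere_eq_0) auto
  then show ?thesis
    using prob_compl[of "sphere 0 1"] by (simp add: Compl_eq_Diff_UNIV)
qed

section \<open>Caps and the function \<open>delta\<close>\<close>

lemma Cap_borel [measurable]: "Cap x \<theta> \<in> sets borel"
proof -
  have "Cap x \<theta> = sphere 0 1 \<inter> {v. cos \<theta> \<le> \<bar>x \<bullet> v\<bar>}"
    by (auto simp: Cap_def)
  also have "closed \<dots>"
    by (intro closed_Int closed_sphere closed_Collect_le continuous_intros)
  finally show ?thesis by simp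
qed

text \<open>An orthogonal map taking the unit vector chosen in \<open>delta\<close> to
  \<open>x\<close> pulls \<open>Cap x \<theta>\<close> back to the cap about that vector.\<close>

lemma measure_Cap:
  fixes x :: "real^'n"
  assumes "norm x = 1"
  shows "measure unif_sphere (Cap x \<theta>) = delta TYPE('n) \<theta>"
proof -
  define a :: "real^'n" where "a = (SOME x. x \<in> sphere 0 1)"
  have "x \<in> sphere 0 1" using assms by simp
  then have "a \<in> sphere 0 1"
    unfolding a_def by (rule someI)
  then have "norm a = 1" by simp
  then obtain f where f: "orthogonal_transformation f" "f a = x"
    using orthogonal_transformation_exists_1 assms by blast
  then have "f -` Cap x \<theta> = Cap a \<theta>"
    by (auto simp: Cap_def orthogonal_transformation_norm orthogonal_transformation_def)
  then show ?thesis
    using measure_unif_sphere_orthogonal_vimage[OF f(1), of "Cap x \<theta>"]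
    by (simp add: delta_def a_def)
qed

text \<open>For \<open>c\<close> outside \<open>[0,1]\<close> only the origin can remain;
  \<open>c = 0\<close> gives a hyperplane, and \<open>c = 1\<close> the line through
  \<open>x\<close> by equality in Cauchy-Schwarz. For \<open>0 < c < 1\<close> each half lies on the
  frontier of a convex cone. In dimension one the case \<open>c = 1\<close> would be the whole
  space.\<close>

lemma negligible_double_cone:
  fixes x :: "real^'n"
  assumes x: "norm x = 1" and n: "CARD('n) \<noteq> 1"
  shows "negligible {v. \<bar>x \<bullet> v\<bar> = c * norm v}"
proof -
  consider "c < 0 \<or> 1 < c" | "c = 0" | "c = 1" | "0 < c" "c < 1" by linarith
  then show ?thesis
  proof cases
    case 1
    have "{v. \<bar>x \<bullet> v\<bar> = c * norm v} \<subseteq> {0}"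
    proof clarsimp
      fix v assume v: "\<bar>x \<bullet> v\<bar> = c * norm v"
      have "0 \<le> c * norm v" "c * norm v \<le> norm v"
        using Cauchy_Schwarz_ineq2[of x v] x by (simp_all add: v[symmetric])
      then show "v = 0"
        using 1 mult_strict_right_mono[of c 0 "norm v"] mult_strict_right_mono[of 1 c "norm v"]
        by (cases "v = 0") auto
    qed
    then show ?thesis
      using negligible_subset negligible_sing by blast
  next
    case 2
    have "{v. \<bar>x \<bullet> v\<bar> = c * norm v} = {v. x \<bullet> v = 0}"
      using 2 by auto
    moreover have "x \<noteq> 0" using x by auto
    ultimately show ?thesis
      using negligible_hyperplane[of x 0] by simp
  next
    case 3
    have "{v. \<bar>x \<bullet> v\<bar> = c * norm v} \<subseteq> span {x}"
    proof
      fix v assume "v \<in> {v. \<bar>x \<bullet> v\<bar> = c * norm v}"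
      then have "v = norm v *\<^sub>R x \<or> v = (- norm v) *\<^sub>R x"
        using 3 x norm_cauchy_schwarz_abs_eq[of x v] by simp
      then show "v \<in> span {x}"
        by (metis span_base span_mul singletonI)
    qed
    moreover have "dim (span {x}) < DIM(real^'n)"
    proof -
      have "dim (span {x}) \<le> card {x}"
        by (simp add: dim_le_card')
      moreover have "1 < CARD('n)"
        using n zero_less_card_finite[where 'a='n] by linarith
      ultimately show ?thesis by simp
    qed
    ultimately show ?thesis
      using negligible_lowdim negligible_subset by blast
  next
    case 4
    have half: "negligible {v. y \<bullet> v = c * norm v}" if y: "norm y = 1" for y :: "real^'n"
    proof -
      let ?C = "{v. c * norm v \<le> y \<bullet> v}"
      have "convex ?C"
      proof (rule convexI)
        fix u v :: "real^'n" and s t :: real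
        assume uv: "u \<in> ?C" "v \<in> ?C" and st: "0 \<le> s" "0 \<le> t" "s + t = 1"
        have "c * norm (s *\<^sub>R u + t *\<^sub>R v) \<le> c * (s * norm u + t * norm v)"
          using norm_triangle_ineq[of "s *\<^sub>R u" "t *\<^sub>R v"] st 4 by (intro mult_left_mono) auto
        also have "\<dots> = s * (c * norm u) + t * (c * norm v)"
          by (simp add: algebra_simps)
        also have "\<dots> \<le> s * (y \<bullet> u) + t * (y \<bullet> v)"
          using uv st by (intro add_mono mult_left_mono) auto
        finally show "s *\<^sub>R u + t *\<^sub>R v \<in> ?C"
          by (simp add: inner_add_right)
      qed
      then have "negligible (frontier ?C)"
        by (rule negligible_convex_frontier)
      moreover have "{v. y \<bullet> v = c * norm v} \<subseteq> frontier ?C"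
      proof clarify
        fix v assume v: "y \<bullet> v = c * norm v"
        have "v \<in> closure ?C"
          using v by (intro closure_subset[THEN subsetD]) simp
        moreover have "v \<notin> interior ?C"
        proof
          assume "v \<in> interior ?C"
          then obtain e where e: "0 < e" "ball v e \<subseteq> ?C"
            by (auto simp: mem_interior)
          \<comment> \<open>A step of length \<open>e/2\<close> against the axis lowers
            \<open>y \<bullet> v\<close> by \<open>e/2\<close> but \<open>c * norm v\<close> by at
            most \<open>c * e/2\<close>, so it leaves the cone.\<close>
          let ?u = "v - (e/2) *\<^sub>R y"
          have "?u \<in> ball v e"
            using e y by (simp add: dist_norm)
          then have "c * norm ?u \<le> y \<bullet> ?u"
            using e by blast
          also have "\<dots> = c * norm v - e/2"
            using y v by (simp add: inner_diff_right norm_eq_1)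
          finally have "c * norm ?u \<le> c * norm v - e/2" .
          moreover have "norm v - e/2 \<le> norm ?u"
            using norm_triangle_ineq2[of v "(e/2) *\<^sub>R y"] y e by simp
          then have "c * (norm v - e/2) \<le> c * norm ?u"
            using 4 by (intro mult_left_mono) auto
          ultimately have "e \<le> c * e"
            by (simp add: right_diff_distrib)
          then show False
            using e 4 by simp
        qed
        ultimately show "v \<in> frontier ?C" by (simp add: frontier_def)
      qed
      ultimately show ?thesis
        using negligible_subset by blast
    qed
    have "{v. \<bar>x \<bullet> v\<bar> = c * norm v} \<subseteq> {v. x \<bullet> v = c * norm v} \<union> {v. (- x) \<bullet> v = c * norm v}"
      by auto
    then show ?thesis
      by (rule negligible_subset[OF negligible_Un[OF half half], rotated 2]) (use x in auto)
  qed
qed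

lemma measure_unif_sphere_level_set:
  fixes x :: "real^'n"
  assumes x: "norm x = 1" and n: "CARD('n) \<noteq> 1"
  shows "measure unif_sphere {v. \<bar>x \<bullet> v\<bar> = c} = 0"
proof (rule measure_unif_sphere_eq_0)
  have "ball 0 1 \<inter> sgn -` {v. \<bar>x \<bullet> v\<bar> = c} \<subseteq> {v. \<bar>x \<bullet> v\<bar> = c * norm v}"
    by (auto simp: sgn_div_norm abs_mult field_simps)
  then show "negligible (ball 0 1 \<inter> sgn -` {v. \<bar>x \<bullet> v\<bar> = c})"
    using negligible_double_cone[OF assms] negligible_subset by blast
qed measurable

text \<open>\<open>delta\<close> is the distribution function of
  \<open>- \<bar>x \<bullet> v\<bar>\<close> evaluated at \<open>- cos \<theta>\<close>, and an atom
  would be a level set of positive measure. The minus signs match the half-lines of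
  \<open>cdf\<close> with the direction of the inequality in \<open>Cap\<close>.\<close>

lemma isCont_delta:
  assumes n: "CARD('n::finite) \<noteq> 1"
  shows "isCont (delta TYPE('n)) \<theta>"
proof -
  interpret prob_space "unif_sphere :: (real^'n) measure"
    by (rule prob_space_unif_sphere)
  obtain x :: "real^'n" where x: "norm x = 1"
    using vector_choose_size[of 1] by auto
  define D where "D = distr unif_sphere borel (\<lambda>v. - \<bar>x \<bullet> v\<bar>)"
  interpret D: real_distribution D
    unfolding D_def by (rule real_distribution_distr) measurable
  have D: "measure D A = measure unif_sphere {v. - \<bar>x \<bullet> v\<bar> \<in> A}" if "A \<in> sets borel" for A
    using that unfolding D_def by (subst measure_distr) (auto simp: vimage_def)
  have "delta TYPE('n) t = cdf D (- cos t)" for t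
  proof -
    have "measure unif_sphere {v. - \<bar>x \<bullet> v\<bar> \<in> {..- cos t}}
        = measure unif_sphere ({v. - \<bar>x \<bullet> v\<bar> \<in> {..- cos t}} \<inter> sphere 0 1)"
    proof (rule measure_eq_AE)
      have "AE v in (unif_sphere :: (real^'n) measure). v \<in> sphere 0 (1::real)"
        by (rule AE_prob_1) (rule measure_unif_sphere_sphere)
      then show "AE v in unif_sphere. v \<in> {v. - \<bar>x \<bullet> v\<bar> \<in> {..- cos t}} \<longleftrightarrow>
          v \<in> {v. - \<bar>x \<bullet> v\<bar> \<in> {..- cos t}} \<inter> sphere 0 1"
        by eventually_elim simp
    qed measurable
    also have "{v. - \<bar>x \<bullet> v\<bar> \<in> {..- cos t}} \<inter> sphere 0 1 = Cap x t"
      by (auto simp: Cap_def)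
    finally show ?thesis
      using measure_Cap[OF x, of t] by (simp add: cdf_def D)
  qed
  then have eq: "delta TYPE('n) = (\<lambda>t. cdf D (- cos t))" by blast
  have cont: "isCont (cdf D) t" for t
  proof -
    have "{v. - \<bar>x \<bullet> v\<bar> \<in> {t}} = {v. \<bar>x \<bullet> v\<bar> = - t}" by auto
    then show ?thesis
      using measure_unif_sphere_level_set[OF x n, of "- t"] D[of "{t}"] by (simp add: D.isCont_cdf)
  qed
  have "isCont (\<lambda>t. - cos t) \<theta>"
    by (intro continuous_intros)
  then show ?thesis
    unfolding eq by (rule isCont_o2[OF _ cont])
qed

text \<open>Between the two caps lies an open band. In the plane of \<open>x\<close> and an
  orthogonal unit vector, the point at angle \<open>(a + b) / 2\<close> shows that it meets the
  sphere.\<close>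

lemma delta_strict_mono:
  assumes n: "CARD('n::finite) \<noteq> 1" and ab: "0 \<le> a" "a < b" "b \<le> pi/2"
  shows "delta TYPE('n) a < delta TYPE('n) b"
proof -
  interpret prob_space "unif_sphere :: (real^'n) measure"
    by (rule prob_space_unif_sphere)
  obtain x :: "real^'n" where x: "norm x = 1"
    using vector_choose_size[of 1] by auto
  have "2 \<le> CARD('n)"
    using n zero_less_card_finite[where 'a='n] by linarith
  then have "2 \<le> DIM(real^'n)" by simp
  then obtain y0 where y0: "y0 \<noteq> 0" "orthogonal x y0"
    using orthogonal_to_vector_exists by blast
  define y where "y = sgn y0"
  have y: "norm y = 1" "x \<bullet> y = 0"
    using y0 by (auto simp: y_def norm_sgn orthogonal_def sgn_div_norm)
  let ?U = "{v. cos b < \<bar>x \<bullet> v\<bar>} \<inter> {v. \<bar>x \<bullet> v\<bar> < cos a}"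
  have cos: "cos b < cos ((a + b) / 2)" "cos ((a + b) / 2) < cos a" "0 \<le> cos b"
    using ab by (auto intro!: cos_monotone_0_pi cos_ge_zero)
  define v where "v = cos ((a + b) / 2) *\<^sub>R x + sin ((a + b) / 2) *\<^sub>R y"
  have "v \<bullet> v = (cos ((a + b) / 2))\<^sup>2 + (sin ((a + b) / 2))\<^sup>2"
    using x y unfolding v_def norm_eq_1
    by (simp add: inner_add_left inner_add_right inner_commute[of y x] power2_eq_square)
  then have "norm v = 1"
    by (simp add: norm_eq_1)
  moreover have "x \<bullet> v = cos ((a + b) / 2)"
    using x y by (simp add: v_def inner_add_right norm_eq_1)
  ultimately have "v \<in> ?U \<inter> sphere 0 1"
    using cos by simp
  moreover have "open ?U"
    by (intro open_Int open_Collect_less continuous_intros)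
  moreover have "?U \<inter> sphere 0 1 \<subseteq> Cap x b - Cap x a"
    by (auto simp: Cap_def)
  ultimately have "0 < measure unif_sphere (Cap x b - Cap x a)"
    by (intro measure_unif_sphere_pos) auto
  also have "\<dots> = measure unif_sphere (Cap x b) - measure unif_sphere (Cap x a)"
    using cos by (intro finite_measure_Diff) (auto simp: Cap_def)
  finally show ?thesis
    by (simp add: measure_Cap[OF x])
qed

lemma delta_0:
  assumes n: "CARD('n::finite) \<noteq> 1"
  shows "delta TYPE('n) 0 = 0"
proof -
  interpret prob_space "unif_sphere :: (real^'n) measure"
    by (rule prob_space_unif_sphere)
  obtain x :: "real^'n" where x: "norm x = 1"
    using vector_choose_size[of 1] by auto
  have "Cap x 0 \<subseteq> {v. \<bar>x \<bullet> v\<bar> = 1}"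
  proof
    fix v assume "v \<in> Cap x 0"
    then show "v \<in> {v. \<bar>x \<bullet> v\<bar> = 1}"
      using Cauchy_Schwarz_ineq2[of x v] x by (simp add: Cap_def)
  qed
  then have "measure unif_sphere (Cap x 0) \<le> measure unif_sphere {v. \<bar>x \<bullet> v\<bar> = 1}"
    by (intro finite_measure_mono) (auto, measurable)
  then show ?thesis
    using measure_unif_sphere_level_set[OF x n, of 1] measure_Cap[OF x, of 0]
      measure_nonneg[of unif_sphere "Cap x 0"] by simp
qed

lemma delta_pi_half: "delta TYPE('n::finite) (pi/2) = 1"
proof -
  obtain x :: "real^'n" where x: "norm x = 1"
    using vector_choose_size[of 1] by auto
  have "Cap x (pi/2) = sphere 0 1"
    by (auto simp: Cap_def)
  then show ?thesis
    using measure_Cap[OF x, of "pi/2"] measure_unif_sphere_sphere[where 'n='n] by simp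
qed

text \<open>The intermediate value theorem gives existence and strict monotonicity uniqueness, so
  the \<open>THE\<close> in \<open>delta_inv\<close> is meaningful.\<close>

lemma delta_inv_bounds:
  assumes n: "CARD('n::finite) \<noteq> 1" and e: "0 < e" "e < 1"
  shows "0 < delta_inv TYPE('n) e" "delta_inv TYPE('n) e \<le> pi/2"
proof -
  let ?P = "\<lambda>\<theta>. 0 \<le> \<theta> \<and> \<theta> \<le> pi/2 \<and> delta TYPE('n) \<theta> = e"
  have "\<exists>\<theta>. ?P \<theta>"
    using IVT'[of "delta TYPE('n)" 0 e "pi/2"] e delta_0[OF n] delta_pi_half[where 'n='n]
      continuous_at_imp_continuous_on[of "{0..pi/2}" "delta TYPE('n)"] isCont_delta[OF n]
    by auto
  moreover have "\<theta> = \<theta>'" if "?P \<theta>" "?P \<theta>'" for \<theta> \<theta>'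
    using that delta_strict_mono[OF n, of \<theta> \<theta>'] delta_strict_mono[OF n, of \<theta>' \<theta>]
    by (cases \<theta> \<theta>' rule: linorder_cases) auto
  ultimately have "\<exists>!\<theta>. ?P \<theta>" by blast
  then have *: "?P (delta_inv TYPE('n) e)"
    unfolding delta_inv_def by (rule theI')
  then show "delta_inv TYPE('n) e \<le> pi/2" by blast
  show "0 < delta_inv TYPE('n) e"
    using * e delta_0[OF n] by (metis less_le)
qed

section \<open>Cap nets and sampling\<close>

text \<open>The triangle inequality for angles. Cauchy-Schwarz on the components orthogonal to
  \<open>w\<close> gives \<open>cos (arccos s + arccos t) \<le> x \<bullet> y\<close>;
  \<open>a + b \<le> pi\<close> keeps both sums where \<open>cos\<close> decreases.\<close>

lemma inner_ge_cos_add: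
  fixes x y w :: "'a::real_inner"
  assumes unit: "norm x = 1" "norm y = 1" "norm w = 1"
    and a: "cos a \<le> x \<bullet> w" "0 \<le> a" and b: "cos b \<le> w \<bullet> y" "0 \<le> b" and ab: "a + b \<le> pi"
  shows "cos (a + b) \<le> x \<bullet> y"
proof -
  define s t where "s = x \<bullet> w" and "t = w \<bullet> y"
  have ww: "x \<bullet> x = 1" "y \<bullet> y = 1" "w \<bullet> w = 1"
    using unit by (simp_all add: norm_eq_1)
  have st: "\<bar>s\<bar> \<le> 1" "\<bar>t\<bar> \<le> 1"
    using Cauchy_Schwarz_ineq2[of x w] Cauchy_Schwarz_ineq2[of w y] unit by (simp_all add: s_def t_def)
  let ?x = "x - s *\<^sub>R w" and ?y = "y - t *\<^sub>R w"
  have "\<bar>?x \<bullet> ?y\<bar> \<le> norm ?x * norm ?y"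
    by (rule Cauchy_Schwarz_ineq2)
  moreover have "?x \<bullet> ?y = x \<bullet> y - s * t"
    by (simp add: inner_diff_left inner_diff_right s_def t_def ww inner_commute)
  moreover have "norm ?x = sqrt (1 - s\<^sup>2)" "norm ?y = sqrt (1 - t\<^sup>2)"
    by (simp_all add: norm_eq_sqrt_inner inner_diff_left inner_diff_right s_def t_def ww
        inner_commute power2_eq_square algebra_simps)
  ultimately have "\<bar>x \<bullet> y - s * t\<bar> \<le> sqrt (1 - s\<^sup>2) * sqrt (1 - t\<^sup>2)"
    by metis
  then have "s * t - sqrt (1 - s\<^sup>2) * sqrt (1 - t\<^sup>2) \<le> x \<bullet> y"
    by linarith
  also have "s * t - sqrt (1 - s\<^sup>2) * sqrt (1 - t\<^sup>2) = cos (arccos s + arccos t)"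
    using st by (simp add: cos_add sin_arccos_abs cos_arccos_abs)
  finally have "cos (arccos s + arccos t) \<le> x \<bullet> y" .
  moreover have "arccos s \<le> a" "arccos t \<le> b"
    using a b ab st arccos_le_mono[of s "cos a"] arccos_le_mono[of t "cos b"]
    by (simp_all add: s_def t_def arccos_cos)
  then have "cos (a + b) \<le> cos (arccos s + arccos t)"
    using ab st by (intro cos_monotone_0_pi_le add_nonneg_nonneg arccos_lbound add_mono) auto
  ultimately show ?thesis by linarith
qed

text \<open>Caps are symmetric, so changing the signs of \<open>x\<close> and \<open>y\<close>
  reduces to the triangle inequality for angles.\<close>

lemma Cap_triangle:
  fixes x y w :: "real^'n"
  assumes "norm x = 1" "w \<in> Cap x a" "y \<in> Cap w b" "0 \<le> a" "0 \<le> b" "a + b \<le> pi"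
  shows "y \<in> Cap x (a + b)"
proof -
  have *: "norm w = 1" "cos a \<le> \<bar>x \<bullet> w\<bar>" "norm y = 1" "cos b \<le> \<bar>w \<bullet> y\<bar>"
    using assms by (auto simp: Cap_def)
  define x' y' where "x' = sgn (x \<bullet> w) *\<^sub>R x" and "y' = sgn (w \<bullet> y) *\<^sub>R y"
  show ?thesis
  proof (cases "x \<bullet> w = 0 \<or> w \<bullet> y = 0")
    case False
    then have "norm x' = 1" "norm y' = 1" "x' \<bullet> w = \<bar>x \<bullet> w\<bar>" "w \<bullet> y' = \<bar>w \<bullet> y\<bar>"
      using * assms(1) by (simp_all add: x'_def y'_def abs_sgn_eq sgn_mult_abs mult.commute abs_sgn)
    then have "cos (a + b) \<le> x' \<bullet> y'"
      using * assms by (intro inner_ge_cos_add[where w=w]) auto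
    also have "\<dots> \<le> \<bar>x \<bullet> y\<bar>"
      by (auto simp: x'_def y'_def sgn_if)
    finally show ?thesis
      using * by (simp add: Cap_def)
  next
    case True
    \<comment> \<open>Here a factor \<open>sgn\<close> is \<open>0\<close> and yields no unit
      vector. Instead one angle is at least a right angle, so \<open>Cap x (a + b)\<close> is the
      whole sphere.\<close>
    have "cos a \<le> 0 \<or> cos b \<le> 0"
      using * True by auto
    then have "pi/2 \<le> a + b"
      using assms cos_gt_zero_pi[of a] cos_gt_zero_pi[of b] pi_gt_zero by (smt (verit))
    then have "cos (a + b) \<le> cos (pi/2)"
      using assms by (intro cos_monotone_0_pi_le) auto
    then show ?thesis
      using * abs_ge_zero[of "x \<bullet> y"] by (simp add: Cap_def)
  qed
qed

lemma Cap_sym: "norm x = 1 \<Longrightarrow> y \<in> Cap x \<theta> \<Longrightarrow> x \<in> Cap y \<theta>"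
  by (simp add: Cap_def inner_commute)

text \<open>Disjoint caps have total measure at most \<open>1\<close>, which bounds every packing
  and makes a largest one exist. For a largest \<open>Z\<close> the cap of radius
  \<open>\<theta>/4\<close> about any \<open>x\<close> meets that of some \<open>z\<close>, and two
  uses of \<open>Cap_triangle\<close> give the inclusion.\<close>

lemma cap_net_packing:
  assumes d: "0 < delta TYPE('n::finite) (\<theta>/4)" and \<theta>: "0 < \<theta>" "\<theta> \<le> pi/2"
  obtains Z :: "(real^'n) set" where "finite Z" "Z \<subseteq> sphere 0 1"
    "real (card Z) * delta TYPE('n) (\<theta>/4) \<le> 1"
    "\<And>x. x \<in> sphere 0 1 \<Longrightarrow> \<exists>z\<in>Z. Cap z (\<theta>/2) \<subseteq> Cap x \<theta>"
proof -
  interpret prob_space "unif_sphere :: (real^'n) measure"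
    by (rule prob_space_unif_sphere)
  let ?d = "delta TYPE('n) (\<theta>/4)"
  define packing where "packing Z \<longleftrightarrow> finite Z \<and> Z \<subseteq> sphere 0 1 \<and>
      disjoint_family_on (\<lambda>z. Cap z (\<theta>/4)) Z" for Z :: "(real^'n) set"
  have card: "real (card Z) * ?d \<le> 1" if "packing Z" for Z
  proof -
    have "real (card Z) * ?d = (\<Sum>z\<in>Z. prob (Cap z (\<theta>/4)))"
      using that by (simp add: packing_def measure_Cap subset_iff)
    also have "\<dots> = prob (\<Union>z\<in>Z. Cap z (\<theta>/4))"
      using that by (intro finite_measure_finite_Union[symmetric]) (auto simp: packing_def)
    also have "\<dots> \<le> 1" by simp
    finally show ?thesis .
  qed
  have "packing {}"
    by (simp add: packing_def disjoint_family_on_def)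
  moreover have "\<forall>Z. packing Z \<longrightarrow> card Z < Suc (nat \<lceil>1 / ?d\<rceil>)"
  proof (intro allI impI)
    fix Z assume "packing Z"
    then have "real (card Z) \<le> 1 / ?d"
      using card d by (simp add: pos_le_divide_eq)
    then show "card Z < Suc (nat \<lceil>1 / ?d\<rceil>)" by linarith
  qed
  ultimately obtain Z where Z: "packing Z" and max: "\<And>Y. packing Y \<Longrightarrow> card Y \<le> card Z"
    using ex_has_greatest_nat[of packing "{}" card] by metis
  have "\<exists>z\<in>Z. Cap z (\<theta>/2) \<subseteq> Cap x \<theta>" if x: "x \<in> sphere 0 1" for x
  proof -
    have "\<exists>z\<in>Z. \<exists>w. w \<in> Cap x (\<theta>/4) \<and> w \<in> Cap z (\<theta>/4)"
    proof (cases "x \<in> Z")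
      case True
      have "x \<in> Cap x (\<theta>/4)"
        using x by (simp add: Cap_def norm_eq_1)
      then show ?thesis using True by blast
    next
      case False
      \<comment> \<open>A new centre whose cap avoids the others would give a larger
        packing.\<close>
      have "\<not> packing (insert x Z)"
        using max[of "insert x Z"] Z False by (auto simp: packing_def)
      then have "\<not> disjoint_family_on (\<lambda>z. Cap z (\<theta>/4)) (insert x Z)"
        using Z x by (simp add: packing_def)
      then show ?thesis
        using Z False by (auto simp: packing_def disjoint_family_on_insert)
    qed
    then obtain z w where z: "z \<in> Z" and w: "w \<in> Cap x (\<theta>/4)" "w \<in> Cap z (\<theta>/4)"
      by blast
    have nz: "norm z = 1" "norm x = 1"
      using z Z x by (auto simp: packing_def)
    have "z \<in> Cap x (\<theta>/4 + \<theta>/4)"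
      by (rule Cap_triangle[OF nz(2) w(1) Cap_sym[OF nz(1) w(2)]]) (use \<theta> in auto)
    then have zx: "z \<in> Cap x (\<theta>/2)" by simp
    have "Cap z (\<theta>/2) \<subseteq> Cap x \<theta>"
    proof
      fix y assume "y \<in> Cap z (\<theta>/2)"
      then show "y \<in> Cap x \<theta>"
        using Cap_triangle[OF nz(2) zx, of y "\<theta>/2"] \<theta> by simp
    qed
    with z show ?thesis by blast
  qed
  then show ?thesis
    using that[of Z] Z card[OF Z] by (simp add: packing_def)
qed

text \<open>In dimension one every cap is the whole sphere, \<^term>\<open>delta\<close> is constantly \<open>1\<close> and
  \<^term>\<open>delta_inv\<close> is an unspecified value, so nothing may be assumed about \<open>\<theta>\<close> here.\<close>

lemma Cap_dim_1:
  fixes x :: "real^'n"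
  assumes n: "CARD('n) = 1" and x: "norm x = 1"
  shows "Cap x \<theta> = sphere 0 1"
proof -
  obtain i :: 'n where i: "UNIV = {i}"
    using n by (auto simp: card_1_singleton_iff)
  have nrm: "norm v = \<bar>v $ i\<bar>" for v :: "real^'n"
    by (simp add: norm_vec_def L2_set_def i)
  have "\<bar>x \<bullet> v\<bar> = norm x * norm v" for v
    by (simp add: inner_vec_def i nrm abs_mult)
  then show ?thesis
    using x by (auto simp: Cap_def)
qed

text \<open>In dimension one a single unit vector is a net; otherwise \<open>\<theta>\<close> lies
  in the range of the packing argument.\<close>

lemma cap_net:
  assumes e: "0 < e" "e < 1"
  defines "\<theta> \<equiv> delta_inv TYPE('n::finite) e"
  obtains Z :: "(real^'n) set" where "finite Z" "Z \<subseteq> sphere 0 1"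
    "0 < delta TYPE('n) (\<theta>/4)" "real (card Z) * delta TYPE('n) (\<theta>/4) \<le> 1"
    "\<And>x. x \<in> sphere 0 1 \<Longrightarrow> \<exists>z\<in>Z. Cap z (\<theta>/2) \<subseteq> Cap x \<theta>"
proof (cases "CARD('n) = 1")
  case True
  obtain x :: "real^'n" where x: "norm x = 1"
    using vector_choose_size[of 1] by auto
  have "delta TYPE('n) t = 1" for t
    using measure_Cap[OF x, of t] Cap_dim_1[OF True x] measure_unif_sphere_sphere[where 'n='n] by simp
  then show ?thesis
    using that[of "{x}"] x Cap_dim_1[OF True] by simp
next
  case False
  have \<theta>: "0 < \<theta>" "\<theta> \<le> pi/2"
    using delta_inv_bounds[OF False e] by (simp_all add: \<theta>_def)
  then have "delta TYPE('n) 0 < delta TYPE('n) (\<theta>/4)"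
    by (intro delta_strict_mono[OF False]) auto
  then have d: "0 < delta TYPE('n) (\<theta>/4)"
    using delta_0[OF False] by simp
  show ?thesis
    using cap_net_packing[OF d \<theta>] that d by metis
qed

section \<open>Probability that every cap is hit in every mode\<close>

lemma prob_space_sample:
  fixes M :: nat
  shows "0 < M \<Longrightarrow> prob_space ((unif_sphere :: (real^'n) measure) \<Otimes>\<^sub>M uniform_count_measure {1..M})"
  by (intro prob_space_pair prob_space_unif_sphere prob_space_uniform_count_measure) auto

text \<open>The event is a product of \<open>N\<close> equal sets, and \<open>C \<times> {i}\<close>
  has probability \<open>measure unif_sphere C / real M\<close> because point and mode are
  independent.\<close>

lemma sample_space_miss:
  fixes C :: "(real^'n) set" and M N i :: nat
  assumes M: "0 < M" and C: "C \<in> sets borel" and i: "i \<in> {1..M}"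
  defines "miss \<equiv> {\<omega> \<in> space (sample_space TYPE('n) M N). \<forall>j<N. \<omega> j \<notin> C \<times> {i}}"
  shows "miss \<in> sets (sample_space TYPE('n) M N)"
    and "measure (sample_space TYPE('n) M N) miss = (1 - measure unif_sphere C / real M) ^ N"
proof -
  let ?U = "unif_sphere :: (real^'n) measure" and ?K = "uniform_count_measure {1..M}"
  interpret Q: prob_space "?U \<Otimes>\<^sub>M ?K"
    by (rule prob_space_sample[OF M])
  interpret U: prob_space ?U
    by (rule prob_space_unif_sphere)
  interpret K: prob_space ?K
    using M by (intro prob_space_uniform_count_measure) auto
  interpret P: finite_product_prob_space "\<lambda>_. ?U \<Otimes>\<^sub>M ?K" "{0..<N}"
    by unfold_locales auto
  let ?A = "space (?U \<Otimes>\<^sub>M ?K) - C \<times> {i}"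
  have CQ: "C \<times> {i} \<in> sets (?U \<Otimes>\<^sub>M ?K)"
    using C i by (intro pair_measureI) (auto simp: sets_uniform_count_measure)
  have miss: "miss = (\<Pi>\<^sub>E j\<in>{0..<N}. ?A)"
  proof (rule set_eqI)
    fix \<omega>
    show "\<omega> \<in> miss \<longleftrightarrow> \<omega> \<in> (\<Pi>\<^sub>E j\<in>{0..<N}. ?A)"
      unfolding miss_def sample_space_def space_PiM PiE_iff mem_Collect_eq Diff_iff
      by (metis atLeastLessThan_iff zero_le)
  qed
  show "miss \<in> sets (sample_space TYPE('n) M N)"
    unfolding miss sample_space_def
    by (rule sets_PiM_I_finite) (simp, rule sets.compl_sets[OF CQ])
  have "emeasure (?U \<Otimes>\<^sub>M ?K) (C \<times> {i}) = emeasure ?U C * emeasure ?K {i}"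
    using C i by (intro K.emeasure_pair_measure_Times) (auto simp: sets_uniform_count_measure)
  then have "measure (?U \<Otimes>\<^sub>M ?K) (C \<times> {i}) = measure ?U C * measure ?K {i}"
    by (simp add: measure_def enn2real_mult)
  also have "\<dots> = measure ?U C / real M"
    using i by (simp add: measure_uniform_count_measure)
  finally have "measure (?U \<Otimes>\<^sub>M ?K) ?A = 1 - measure ?U C / real M"
    using Q.prob_compl[OF CQ] by simp
  then show "measure (sample_space TYPE('n) M N) miss = (1 - measure unif_sphere C / real M) ^ N"
    unfolding miss sample_space_def
    using P.prob_times[of "\<lambda>_. ?A"] sets.compl_sets[OF CQ] by simp
qed

text \<open>Union bound over centres and modes. In the application \<open>\<phi>\<close> is
  \<open>\<theta>/2\<close> and \<open>d\<close> is \<open>delta\<close> at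
  \<open>\<theta>/4\<close>, the two radii in \<open>conf_bound\<close>.\<close>

lemma prob_all_hit:
  fixes Z :: "(real^'n) set" and M N :: nat and d \<phi> :: real
  assumes M: "0 < M" and Z: "finite Z" "Z \<subseteq> sphere 0 1"
    and d: "0 < d" "real (card Z) * d \<le> 1"
  defines "E \<equiv> {\<omega> \<in> space (sample_space TYPE('n) M N).
      \<forall>z\<in>Z. \<forall>i\<in>{1..M}. \<exists>j<N. \<omega> j \<in> Cap z \<phi> \<times> {i}}"
  shows "E \<in> sets (sample_space TYPE('n) M N)"
    and "1 - real M * (1 - delta TYPE('n) \<phi> / real M) ^ N / d \<le> measure (sample_space TYPE('n) M N) E"
proof -
  let ?S = "sample_space TYPE('n) M N"
  interpret prob_space ?S
    unfolding sample_space_def by (intro prob_space_PiM prob_space_sample M)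
  define miss where
    "miss p = {\<omega> \<in> space ?S. \<forall>j<N. \<omega> j \<notin> Cap (fst p) \<phi> \<times> {snd p}}" for p :: "(real^'n) \<times> nat"
  let ?I = "Z \<times> {1..M}"
  let ?q = "(1 - delta TYPE('n) \<phi> / real M) ^ N"
  have meas: "miss p \<in> sets ?S" and prob: "measure ?S (miss p) = ?q" if "p \<in> ?I" for p
  proof -
    have p: "snd p \<in> {1..M}" "norm (fst p) = 1"
      using that Z by auto
    show "miss p \<in> sets ?S"
      unfolding miss_def by (rule sample_space_miss(1)[OF M Cap_borel p(1)])
    show "measure ?S (miss p) = ?q"
      unfolding miss_def using sample_space_miss(2)[where N=N, OF M Cap_borel[of "fst p" \<phi>] p(1)] measure_Cap[OF p(2)] by simp
  qed
  have E: "E = space ?S - (\<Union>p\<in>?I. miss p)"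
    unfolding E_def miss_def by (fastforce simp del: mem_Sigma_iff)
  have U: "(\<Union>p\<in>?I. miss p) \<in> sets ?S"
    using meas Z by (intro sets.finite_UN) auto
  then show "E \<in> sets ?S"
    unfolding E by auto
  \<comment> \<open>Needed to multiply \<open>card Z \<le> 1 / d\<close> by \<open>?q\<close>. A
    nonempty index set makes \<open>?q\<close> a probability; for \<open>Z = {}\<close> it follows
    from \<open>delta\<close> being at most \<open>1\<close>.\<close>
  have q: "0 \<le> ?q"
  proof (cases "?I = {}")
    case False
    then show ?thesis using prob measure_nonneg by (metis ex_in_conv)
  next
    case True
    then have "Z = {}" using M by simp
    obtain x :: "real^'n" where x: "norm x = 1"
      using vector_choose_size[of 1] by auto
    have "delta TYPE('n) \<phi> \<le> 1"
      using prob_space.prob_le_1[OF prob_space_unif_sphere] measure_Cap[OF x] by metis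
    then have "delta TYPE('n) \<phi> \<le> real M" using M by linarith
    then show ?thesis using M by simp
  qed
  have "prob (\<Union>p\<in>?I. miss p) \<le> (\<Sum>p\<in>?I. prob (miss p))"
    using meas Z by (intro measure_UNION_le) auto
  also have "\<dots> = real (card Z) * real M * ?q"
    using prob by (simp add: card_cartesian_product)
  also have "\<dots> \<le> (1 / d) * real M * ?q"
    using d q by (intro mult_right_mono) (auto simp: field_simps)
  finally have "prob (\<Union>p\<in>?I. miss p) \<le> real M * ?q / d"
    by simp
  then show "1 - real M * ?q / d \<le> prob E"
    using prob_compl[OF U] by (simp add: E)
qed

text \<open>A measurable \<open>E\<close> inside the good set avoids asserting measurability of that
  set. All outputs are covered, as the solvers may return any optimum, and the premise on
  \<open>kappa P\<close> encodes the convention of an infinite bound.\<close>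

theorem theorem1:
  fixes A :: "nat \<Rightarrow> real^'n^'n" and B :: "real^'m^'n"
    and M N :: nat and tol e :: real
  assumes "0 < M" and "0 < tol" and "0 < e" and "e < 1"
  shows "\<exists>E \<in> sets (sample_space TYPE('n) M N).
     E \<subseteq> {\<omega> \<in> space (sample_space TYPE('n) M N).
             \<forall>g P K. alg1_output A B (\<omega> ` {0..<N}) tol g P K \<longrightarrow>
               kappa P * (1 - cos (delta_inv TYPE('n) e)) < 1 \<longrightarrow>
               jsr (\<lambda>i. A i + B ** K) {1..M}
                 \<le> g / (1 - kappa P * (1 - cos (delta_inv TYPE('n) e)))} \<and>
     1 - conf_bound TYPE('n) M e N \<le> measure (sample_space TYPE('n) M N) E"
proof -
  define \<theta> where "\<theta> = delta_inv TYPE('n) e"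
  obtain Z :: "(real^'n) set" where Z: "finite Z" "Z \<subseteq> sphere 0 1"
    and d: "0 < delta TYPE('n) (\<theta>/4)" "real (card Z) * delta TYPE('n) (\<theta>/4) \<le> 1"
    and net: "\<And>x. x \<in> sphere 0 1 \<Longrightarrow> \<exists>z\<in>Z. Cap z (\<theta>/2) \<subseteq> Cap x \<theta>"
    unfolding \<theta>_def by (rule cap_net[OF assms(3,4)]) blast
  \<comment> \<open>\<open>E\<close> is defined by the samples alone. On it the bound holds for all
    outputs at once, although \<open>P\<close> and \<open>K\<close> are computed from the same
    samples.\<close>
  define E where "E = {\<omega> \<in> space (sample_space TYPE('n) M N).
      \<forall>z\<in>Z. \<forall>i\<in>{1..M}. \<exists>j<N. \<omega> j \<in> Cap z (\<theta>/2) \<times> {i}}"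
  have E: "E \<in> sets (sample_space TYPE('n) M N)"
    unfolding E_def by (rule prob_all_hit(1)[OF assms(1) Z d])
  have prob_E: "1 - conf_bound TYPE('n) M e N \<le> measure (sample_space TYPE('n) M N) E"
    unfolding E_def conf_bound_def \<theta>_def[symmetric] by (rule prob_all_hit(2)[OF assms(1) Z d])
  have bound: "jsr (\<lambda>i. A i + B ** K) {1..M} \<le> g / (1 - kappa P * (1 - cos \<theta>))"
    if \<omega>: "\<omega> \<in> E" and out: "alg1_output A B (\<omega> ` {0..<N}) tol g P K"
      and kappa: "kappa P * (1 - cos \<theta>) < 1" for \<omega> g P K
  proof -
    note feas = alg1_output_feasible[OF out]
    have contr: "((A i + B ** K) *v x) \<bullet> (P *v ((A i + B ** K) *v x))
        \<le> (g / (1 - kappa P * (1 - cos \<theta>)))\<^sup>2 * (x \<bullet> (P *v x))" if i: "i \<in> {1..M}" for i x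
    proof (rule contraction_from_samples[OF feas(2,3) _ kappa])
      fix x :: "real^'n" assume x: "norm x = 1"
      then obtain z where z: "z \<in> Z" "Cap z (\<theta>/2) \<subseteq> Cap x \<theta>"
        using net[of x] by auto
      from \<omega> have "\<forall>z\<in>Z. \<forall>i\<in>{1..M}. \<exists>j<N. \<omega> j \<in> Cap z (\<theta>/2) \<times> {i}"
        unfolding E_def mem_Collect_eq by (rule conjunct2)
      from bspec[OF bspec[OF this z(1)] i]
      obtain j where j: "j < N \<and> \<omega> j \<in> Cap z (\<theta>/2) \<times> {i}"
        by (rule exE)
      then obtain y where y: "\<omega> j = (y, i)" "y \<in> Cap x \<theta>"
        using z(2) by auto
      have "(y, i) \<in> \<omega> ` {0..<N}"
        using j y(1) by force
      then have "((A i + B ** K) *v y) \<bullet> (P *v ((A i + B ** K) *v y)) \<le> g\<^sup>2 * (y \<bullet> (P *v y))"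
        by (rule feas(4))
      then show "\<exists>y. norm y = 1 \<and> cos \<theta> \<le> \<bar>x \<bullet> y\<bar> \<and>
          ((A i + B ** K) *v y) \<bullet> (P *v ((A i + B ** K) *v y)) \<le> g\<^sup>2 * (y \<bullet> (P *v y))"
        using y(2) by (auto simp: Cap_def)
    qed auto
    show ?thesis
      using assms(1) feas(1) kappa by (intro jsr_le[OF _ _ _ feas(2,3) contr]) auto
  qed
  have "E \<subseteq> {\<omega> \<in> space (sample_space TYPE('n) M N).
             \<forall>g P K. alg1_output A B (\<omega> ` {0..<N}) tol g P K \<longrightarrow>
               kappa P * (1 - cos \<theta>) < 1 \<longrightarrow>
               jsr (\<lambda>i. A i + B ** K) {1..M} \<le> g / (1 - kappa P * (1 - cos \<theta>))}"
    using bound unfolding E_def by auto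
  with E prob_E show ?thesis
    unfolding \<theta>_def by blast
qed

end
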